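(* Let $f:\mathbb{R}^n\to\mathbb{R}$ be continuously differentiable with locally Lipschitz continuous gradient, let $P_1:\mathbb{R}^n\to(-\infty,\infty]$ be proper, closed (lower semicontinuous) and prox-bounded (there is $\gamma>0$ with $\inf\{P_1+\frac{\gamma}{2}\|\cdot\|^2\}>-\infty$), let $P_2:\mathbb{R}^n\to\mathbb{R}$ be convex, and suppose $F:=f+P_1-P_2$ is bounded from below on $\mathrm{dom}\,P_1$. Let $\mathcal{S}$ be the set of stationary points of $\min_{\bm{x}\in\mathbb{R}^n}F(\bm{x})$, and suppose that $P_2$ is continuously differentiable on an open set $\mathcal{N}_{\mathcal{S}}$ containing $\mathcal{S}$ and that $\nabla P_2$ is locally Lipschitz continuous on $\mathcal{N}_{\mathcal{S}}$. Let the parameters satisfy $0<\gamma_{\min}\leq\gamma_{\max}<\infty$, $\beta_{\max}\geq0$, $0<p_{\min}<1$, $0\leq\delta<1$, $\tau>1$, $0<\eta<\frac{1}{\sqrt{\tau}}$, let $\{\bm{x}^k\}$ be a sequence generated by the algorithm nexPGA, and let $\zeta:=\lim_{k\to\infty}\mathcal{R}_k$ (this limit exists), where $\mathcal{R}_k$ are the reference values of the algorithm. Suppose that $\{\bm{x}^k\}$ has an accumulation point $\bm{x}^*$ and that the potential function $H_\delta(\bm{u},\bm{v},\gamma)=F(\bm{u})+\frac{\delta\gamma}{8}\|\bm{u}-\bm{v}\|^2$ is a KL function with an exponent $\theta\in[0,1)$. Then: (i) If $\theta=0$, there exist $c_1>0$ and $\eta_1\in(0,1)$ such that $\zeta-c_1\eta_1^k\le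 F(\bm{x}^k)\le\zeta$ for all sufficiently large $k$. (ii) If $\theta\in(0,\frac12]$, there exist $c_2>0$ and $\eta_2\in(0,1)$ such that $|F(\bm{x}^k)-\zeta|\le c_2\eta_2^k$ for all sufficiently large $k$. (iii) If $\theta\in(\frac12,1)$, there exists $c_3>0$ such that $|F(\bm{x}^k)-\zeta|\le c_3k^{-\frac{1}{2\theta-1}}$ for all sufficiently large $k$.
   Context: $\|\cdot\|$ is the Euclidean norm. For a proper function $h$, $\partial h$ is the limiting subdifferential: for $\bm{x}\in\mathrm{dom}\,h$, $\bm{d}\in\partial h(\bm{x})$ iff there are $\bm{x}^k\to\bm{x}$ with $h(\bm{x}^k)\to h(\bm{x})$ and $\bm{d}^k\to\bm{d}$ with $\bm{d}^k\in\widehat\partial h(\bm{x}^k)$ for all $k$, where $\widehat\partial h(\bm{y})$ is the Fréchet subdifferential, i.e. the set of $\bm{d}$ with $\liminf_{\bm{z}\to\bm{y},\bm{z}\neq\bm{y}}\frac{h(\bm{z})-h(\bm{y})-\langle\bm{d},\bm{z}-\bm{y}\rangle}{\|\bm{z}-\bm{y}\|}\ge0$. For convex $h$ it is the usual convex subdifferential. Stationary point: $\bm{x}^*\in\mathrm{dom}\,F$ with $0\in\nabla f(\bm{x}^* )+\partial P_1(\bm{x}^* )-\partial P_2(\bm{x}^* )$. Potential function: $H_\delta(\bm{u},\bm{v},\gamma):=F(\bm{u})+\frac{\delta\gamma}{8}\|\bm{u}-\bm{v}\|^2$ for $\bm{u},\bm{v}\in\mathbb{R}^n$, $\gamma>0$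 (a function on $\mathbb{R}^n\times\mathbb{R}^n\times(0,\infty)$; its subdifferential and the KL property are taken at points with $\gamma>0$, with respect to all three variables). KL property: for $\nu>0$ let $\Phi_\nu$ be the class of concave $\varphi:[0,\nu)\to\mathbb{R}_+$ with $\varphi(0)=0$, $\varphi$ continuous at $0$ and continuously differentiable on $(0,\nu)$, and $\varphi'>0$ on $(0,\nu)$. A proper closed function $h$ has the KL property at $\tilde{\bm{x}}\in\mathrm{dom}\,\partial h$ if there are $\nu\in(0,+\infty]$, a neighborhood $\mathcal{V}$ of $\tilde{\bm{x}}$ and $\varphi\in\Phi_\nu$ such that $\varphi'(h(\bm{x})-h(\tilde{\bm{x}}))\,\mathrm{dist}(\bm{0},\partial h(\bm{x}))\ge1$ for all $\bm{x}\in\mathcal{V}$ with $h(\tilde{\bm{x}})<h(\bm{x})<h(\tilde{\bm{x}})+\nu$. $h$ is a KL function if it has the KL property at each point of $\mathrm{dom}\,\partial h$; it is a KL function with an exponent $\theta\in[0,1)$ if moreover $\varphi$ can be chosen (at each such point) as $\varphi(t)=\tilde{a}t^{1-\theta}$ for some $\tilde{a}>0$. Algorithm nexPGA. Start from $\bm{x}^0\in\mathrm{dom}\,P_1$; set $\bm{x}^{-1}=\bm{x}^0$, $\overline\gamma_{-1}=\gamma_{\min}$, $\mathcal{R}_0=F(\bm{x}^0)$. For $k=0,1,2,\dots$ (run indefinitely): Step 1: take any $\bm{\xi}^k\in\partial P_2(\bm{x}^k)$ and arbitrary $\beta_{k,0}\in[0,\delta\beta_{\max}]$, $\gamma_{k,0}\in[\gamma_{\min},\gamma_{\max}]$.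 For $i=0,1,2,\dots$, with $\beta_{k,i}=\eta^i\beta_{k,0}$ and $\gamma_{k,i}=\tau^i\gamma_{k,0}$, set $\bm{y}^{k,i}=\bm{x}^k+\beta_{k,i}(\bm{x}^k-\bm{x}^{k-1})$, and take any global minimizer $$\bm{x}^{k,i}\in\arg\min_{\bm{x}\in\mathbb{R}^n}\Big\{\langle\nabla f(\bm{y}^{k,i})-\bm{\xi}^k,\bm{x}-\bm{y}^{k,i}\rangle+\tfrac{\gamma_{k,i}}{2}\|\bm{x}-\bm{y}^{k,i}\|^2+P_1(\bm{x})\Big\}$$ (if no minimizer exists, trial $i$ counts as failed). Stop the inner loop at the first $i$ for which the line search criterion $H_\delta(\bm{x}^{k,i},\bm{x}^k,\gamma_{k,i})-\mathcal{R}_k\le-\frac{(1-\delta)\gamma_{k,i}}{8}\|\bm{x}^{k,i}-\bm{x}^k\|^2$ holds. Step 2: with that $i$, set $\overline\beta_k=\beta_{k,i}$, $\overline\gamma_k=\gamma_{k,i}$, $\bm{x}^{k+1}=\bm{x}^{k,i}$; choose any $p_{k+1}\in[p_{\min},1]$ and set $\mathcal{R}_{k+1}=(1-p_{k+1})\mathcal{R}_k+p_{k+1}H_\delta(\bm{x}^{k+1},\bm{x}^k,\overline\gamma_k)$. *)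

theory Defs
  imports "HOL-Analysis.Analysis"
begin

definition edom :: "('a \<Rightarrow> ereal) \<Rightarrow> 'a set" where
  "edom h = {x. h x < \<infinity>}"

definition proper_fun :: "('a \<Rightarrow> ereal) \<Rightarrow> bool" where
  "proper_fun h \<longleftrightarrow> (\<forall>x. h x \<noteq> -\<infinity>) \<and> edom h \<noteq> {}"

text \<open>A closed function is a lower semicontinuous one.\<close>

definition closed_fun :: "('a::topological_space \<Rightarrow> ereal) \<Rightarrow> bool" where
  "closed_fun h \<longleftrightarrow> (\<forall>x. h x \<le> Liminf (at x) h)"

definition prox_bounded :: "('a::real_normed_vector \<Rightarrow> ereal) \<Rightarrow> bool" where
  "prox_bounded h \<longleftrightarrow>
     (\<exists>\<gamma>>0. (INF x. h x + ereal (\<gamma> / 2 * (norm x)\<^sup>2)) > -\<infinity>)"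

text \<open>Both subdifferentials are empty outside the effective domain. For points of the domain
  \<^term>\<open>at y\<close> excludes \<open>z = y\<close>, as in the defining lower limit.\<close>

definition frechet_subdiff :: "('a::real_inner \<Rightarrow> ereal) \<Rightarrow> 'a \<Rightarrow> 'a set" where
  "frechet_subdiff h y =
     {d. y \<in> edom h \<and>
         0 \<le> Liminf (at y) (\<lambda>z. (h z - h y - ereal (d \<bullet> (z - y))) / ereal (norm (z - y)))}"

definition limiting_subdiff :: "('a::real_inner \<Rightarrow> ereal) \<Rightarrow> 'a \<Rightarrow> 'a set" where
  "limiting_subdiff h x =
     {d. x \<in> edom h \<and>
         (\<exists>(u :: nat \<Rightarrow> 'a) (v :: nat \<Rightarrow> 'a).
            u \<longlonglongrightarrow> x \<and> (\<lambda>k. h (u k)) \<longlonglongrightarrow> h x \<and> v \<longlonglongrightarrow> d \<and>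
            (\<forall>k. v k \<in> frechet_subdiff h (u k)))}"

definition grad :: "('a::real_inner \<Rightarrow> real) \<Rightarrow> 'a \<Rightarrow> 'a" where
  "grad f x = (THE D. GDERIV f x :> D)"

definition continuously_differentiable_on :: "'a set \<Rightarrow> ('a::euclidean_space \<Rightarrow> real) \<Rightarrow> bool" where
  "continuously_differentiable_on S f \<longleftrightarrow>
     (\<forall>x\<in>S. f differentiable (at x)) \<and> continuous_on S (grad f)"

definition locally_lipschitz_on :: "'a::metric_space set \<Rightarrow> ('a \<Rightarrow> 'b::metric_space) \<Rightarrow> bool" where
  "locally_lipschitz_on S g \<longleftrightarrow> (\<forall>x\<in>S. \<exists>r>0. \<exists>L. L-lipschitz_on (ball x r \<inter> S) g)"

definition desingularizing :: "ereal \<Rightarrow> (real \<Rightarrow> real) set" where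
  "desingularizing \<nu> =
     {\<phi>. let I = {t. 0 \<le> t \<and> ereal t < \<nu>}; J = {t. 0 < t \<and> ereal t < \<nu>} in
         concave_on I \<phi> \<and> (\<forall>t\<in>I. 0 \<le> \<phi> t) \<and> \<phi> 0 = 0 \<and>
         continuous (at 0 within I) \<phi> \<and>
         (\<forall>t\<in>J. \<phi> differentiable (at t)) \<and> continuous_on J (deriv \<phi>) \<and>
         (\<forall>t\<in>J. 0 < deriv \<phi> t)}"

text \<open>The distance from the origin to a set; it is \<open>\<infinity>\<close> for the empty set
  (unlike \<^const>\<open>infdist\<close>, which is then \<open>0\<close>).\<close>

definition dist0 :: "'a::real_normed_vector set \<Rightarrow> ereal" where
  "dist0 A = (INF d\<in>A. ereal (norm d))"

definition KL_at_with_exponent :: "('a::real_inner \<Rightarrow> ereal) \<Rightarrow> real \<Rightarrow> 'a \<Rightarrow> bool" where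
  "KL_at_with_exponent h \<theta> z \<longleftrightarrow>
     (\<exists>(\<nu>::ereal) V \<phi> a. 0 < \<nu> \<and> open V \<and> z \<in> V \<and> \<phi> \<in> desingularizing \<nu> \<and>
        0 < a \<and> (\<forall>t. 0 \<le> t \<and> ereal t < \<nu> \<longrightarrow> \<phi> t = a * t powr (1 - \<theta>)) \<and>
        (\<forall>x\<in>V. h z < h x \<and> h x < h z + \<nu> \<longrightarrow>
           1 \<le> ereal (deriv \<phi> (real_of_ereal (h x - h z))) * dist0 (limiting_subdiff h x)))"

text \<open>The set \<open>D\<close> is an open set on which \<open>h\<close> is considered as a function. Subdifferentials and
  the KL property at a point of \<open>D\<close> only depend on \<open>h\<close> near that point, so they agree with
  those of the restriction of \<open>h\<close> to \<open>D\<close>.\<close>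

definition KL_function_on_with_exponent ::
  "'a set \<Rightarrow> ('a::real_inner \<Rightarrow> ereal) \<Rightarrow> real \<Rightarrow> bool" where
  "KL_function_on_with_exponent D h \<theta> \<longleftrightarrow>
     proper_fun h \<and> closed_fun h \<and>
     (\<forall>z\<in>D. limiting_subdiff h z \<noteq> {} \<longrightarrow> KL_at_with_exponent h \<theta> z)"

definition objective ::
  "('a \<Rightarrow> real) \<Rightarrow> ('a \<Rightarrow> ereal) \<Rightarrow> ('a \<Rightarrow> real) \<Rightarrow> 'a \<Rightarrow> ereal" where
  "objective f P1 P2 x = ereal (f x) + P1 x - ereal (P2 x)"

definition stationary_points ::
  "('a::euclidean_space \<Rightarrow> real) \<Rightarrow> ('a \<Rightarrow> ereal) \<Rightarrow> ('a \<Rightarrow> real) \<Rightarrow> 'a set" where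
  "stationary_points f P1 P2 =
     {x \<in> edom (objective f P1 P2).
        \<exists>a \<in> limiting_subdiff P1 x. \<exists>b \<in> limiting_subdiff (\<lambda>u. ereal (P2 u)) x.
          0 = grad f x + a - b}"

definition potential :: "real \<Rightarrow> ('a::real_normed_vector \<Rightarrow> ereal) \<Rightarrow> 'a \<times> 'a \<times> real \<Rightarrow> ereal" where
  "potential \<delta> F = (\<lambda>(u, v, \<gamma>). F u + ereal (\<delta> * \<gamma> / 8 * (norm (u - v))\<^sup>2))"

definition subproblem ::
  "('a::euclidean_space \<Rightarrow> real) \<Rightarrow> ('a \<Rightarrow> ereal) \<Rightarrow> 'a \<Rightarrow> 'a \<Rightarrow> real \<Rightarrow> 'a \<Rightarrow> ereal" where
  "subproblem f P1 \<xi> y \<gamma> z =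
     ereal ((grad f y - \<xi>) \<bullet> (z - y) + \<gamma> / 2 * (norm (z - y))\<^sup>2) + P1 z"

definition line_search ::
  "real \<Rightarrow> ('a::euclidean_space \<Rightarrow> ereal) \<Rightarrow> real \<Rightarrow> real \<Rightarrow> 'a \<Rightarrow> 'a \<Rightarrow> bool" where
  "line_search \<delta> F r \<gamma> xc w \<longleftrightarrow>
     potential \<delta> F (w, xc, \<gamma>) - ereal r \<le> ereal (- ((1 - \<delta>) * \<gamma> / 8 * (norm (w - xc))\<^sup>2))"

text \<open>\<open>nexPGA \<dots> x R\<close> says that \<open>x\<close> is a sequence of iterates of an infinite run and \<open>R\<close> the
  corresponding sequence of reference values. The witnesses are: the subgradients \<open>\<xi>\<close>, the initial
  extrapolation and proximal parameters \<open>\<beta>0\<close>, \<open>\<gamma>0\<close>, the trial points \<open>X k i\<close>, the index \<open>J k\<close> at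
  which the inner loop of iteration \<open>k\<close> stops, and the averaging weights \<open>p\<close>. A trial \<open>i < J k\<close> has
  failed, either because the subproblem has no minimizer or because the chosen minimizer violates
  the line search criterion. The convention \<open>x\<^sup>-\<^sup>1 = x\<^sup>0\<close> is expressed by the truncated subtraction in
  \<open>x (k - 1)\<close>. All potential values at accepted points are finite, so \<open>R\<close> is real-valued.\<close>

definition nexPGA ::
  "('a::euclidean_space \<Rightarrow> real) \<Rightarrow> ('a \<Rightarrow> ereal) \<Rightarrow> ('a \<Rightarrow> real) \<Rightarrow>
   real \<Rightarrow> real \<Rightarrow> real \<Rightarrow> real \<Rightarrow> real \<Rightarrow> real \<Rightarrow> real \<Rightarrow>
   (nat \<Rightarrow> 'a) \<Rightarrow> (nat \<Rightarrow> real) \<Rightarrow> bool" where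
  "nexPGA f P1 P2 \<gamma>min \<gamma>max \<beta>max pmin \<delta> \<tau> \<eta> x R \<longleftrightarrow>
     x 0 \<in> edom P1 \<and> ereal (R 0) = objective f P1 P2 (x 0) \<and>
     (\<exists>(\<xi> :: nat \<Rightarrow> 'a) (\<beta>0 :: nat \<Rightarrow> real) (\<gamma>0 :: nat \<Rightarrow> real)
        (X :: nat \<Rightarrow> nat \<Rightarrow> 'a) (J :: nat \<Rightarrow> nat) (p :: nat \<Rightarrow> real).
        \<forall>k. let F = objective f P1 P2;
                \<gamma> = (\<lambda>i. \<tau> ^ i * \<gamma>0 k);
                y = (\<lambda>i. x k + (\<eta> ^ i * \<beta>0 k) *\<^sub>R (x k - x (k - 1)));
                minimizer = (\<lambda>i. is_arg_min (subproblem f P1 (\<xi> k) (y i) (\<gamma> i)) (\<lambda>_. True))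
            in \<xi> k \<in> limiting_subdiff (\<lambda>u. ereal (P2 u)) (x k) \<and>
               \<beta>0 k \<in> {0..\<delta> * \<beta>max} \<and> \<gamma>0 k \<in> {\<gamma>min..\<gamma>max} \<and>
               (\<forall>i<J k. (\<nexists>w. minimizer i w) \<or>
                  minimizer i (X k i) \<and> \<not> line_search \<delta> F (R k) (\<gamma> i) (x k) (X k i)) \<and>
               minimizer (J k) (X k (J k)) \<and>
               line_search \<delta> F (R k) (\<gamma> (J k)) (x k) (X k (J k)) \<and>
               x (Suc k) = X k (J k) \<and>
               p (Suc k) \<in> {pmin..1} \<and>
               ereal (R (Suc k)) = ereal ((1 - p (Suc k)) * R k)
                 + ereal (p (Suc k)) * potential \<delta> F (x (Suc k), x k, \<gamma> (J k)))"

end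

(* With r_k = R_k - zeta, the line search gives r_k - r_(k+1) >= const * |x_(k+1) - x_k|^2, and R_(k+1)
   is an average of R_k and the potential value H_k at the accepted point. If H_k <= zeta, averaging
   alone contracts r_k; if H_k > zeta, the KL inequality bounds (H_k - zeta)^theta by the length of the
   last two steps. Either way r_(k-1) - r_(k+1) >= c * r_(k-1)^s with s = max 1 (2 theta) < 2, as long as
   x_k is near the accumulation point. Then |x_(k+1) - x_k| is dominated by a decrement of
   r^(1 - s/2), so the remaining path is short and the iterates never leave the neighbourhood.
   The recursion yields the rates for r_k, and |F(x_(k+1)) - zeta| is bounded by a multiple of r_k.

   The KL neighbourhood has to be uniform in the proximal parameters. These are bounded near the
   accumulation point: a failed trial with a large parameter would have a minimizer in a fixed ball,
   where grad f is Lipschitz, so it would have passed the line search; eta^2 * tau < 1 absorbs the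
   extrapolation term. *)

theory Submission
  imports Defs
begin

section \<open>Scalar recursions\<close>

text \<open>The recursion spans two iterations because the subgradient of the potential at the
  accepted point contains differences to the extrapolated point, which depends on
  \<open>x (k - 1)\<close>; two consecutive decreases of the reference value pay for both steps. The
  exponent is cut off at 1 since averaging guarantees only a linear contraction. For \<theta> = 0
  the KL inequality above \<zeta> would keep the steps away from 0, so the potential values end up
  at most \<zeta>: this is the one-sided bound in (i).

  KL is usable at \<open>(z, z, \<gamma>)\<close> only if the potential has the value \<zeta> and a
  subgradient there. Both rest on comparing accepted minimizers with z itself, since lower
  semicontinuity gives just one of the two inequalities for F z.

  Extrapolation may raise the objective. The compensation is stored in the reference value:
  \<open>R k\<close> dominates the previous potential, hence F (x k) plus a multiple of the squared
  previous step. The factor \<delta> occurs in that multiple and in the bound on the extrapolation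
  parameters alike, so the balance holds down to \<delta> = 0.\<close>

lemma powr_tangent_le:
  fixes a b q :: real
  assumes "0 < a" "0 \<le> b" "0 < q" "q < 1"
  shows "b powr q \<le> a powr q - q * a powr (q - 1) * (a - b)"
proof -
  have a: "a powr (q - 1) * a = a powr q"
    using assms(1) by (simp add: powr_diff)
  show ?thesis
  proof (cases "b = 0")
    case True
    then show ?thesis
      using assms a by (simp add: mult.assoc mult_left_le_one_le)
  next
    case False
    \<comment> \<open>Weighted arithmetic-geometric mean; multiplied by
      \<open>a powr (q - 1)\<close> it is the tangent inequality of the concave power.\<close>
    then have "b powr q * a powr (1 - q) \<le> q * b + (1 - q) * a"
      using Youngs_inequality_0[of q "1 - q" b a] assms by simp
    then have "(b powr q * a powr (1 - q)) * a powr (q - 1) \<le> (q * b + (1 - q) * a) * a powr (q - 1)"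
      by (rule mult_right_mono) simp
    moreover have "(b powr q * a powr (1 - q)) * a powr (q - 1) = b powr q"
      using assms(1) by (simp add: mult.assoc flip: powr_add)
    moreover have "(q * b + (1 - q) * a) * a powr (q - 1) = a powr q - q * a powr (q - 1) * (a - b)"
      by (simp add: algebra_simps flip: a)
    ultimately show ?thesis by linarith
  qed
qed

text \<open>Convexity of the negative power, from \<open>ln t \<le> t - 1\<close> and
  \<open>1 + t \<le> exp t\<close> at the ratio \<open>b / a\<close>. It measures how much the
  reciprocal power of a gap grows when the gap shrinks.\<close>

lemma powr_minus_tangent_ge:
  fixes a b \<sigma> :: real
  assumes "0 < b" "b \<le> a" "0 < \<sigma>"
  shows "b powr (- \<sigma>) \<ge> a powr (- \<sigma>) + \<sigma> * a powr (- \<sigma> - 1) * (a - b)"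
proof -
  have a: "0 < a" using assms by linarith
  have "\<sigma> * ln (b / a) \<le> \<sigma> * (b / a - 1)"
    using ln_le_minus_one[of "b / a"] assms a by (intro mult_left_mono) auto
  then have "1 + \<sigma> * (1 - b / a) \<le> 1 + (- \<sigma> * ln (b / a))"
    by (simp add: right_diff_distrib)
  also have "\<dots> \<le> exp (- \<sigma> * ln (b / a))"
    by (rule exp_ge_add_one_self)
  also have "\<dots> = (b / a) powr (- \<sigma>)"
    using assms a by (simp add: powr_def)
  finally have "1 + \<sigma> * (1 - b / a) \<le> (b / a) powr (- \<sigma>)" .
  then have "a powr (- \<sigma>) * (1 + \<sigma> * (1 - b / a)) \<le> a powr (- \<sigma>) * (b / a) powr (- \<sigma>)"
    by (rule mult_left_mono) simp
  also have "\<dots> = b powr (- \<sigma>)"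
    using a assms by (simp flip: powr_mult)
  also have "a powr (- \<sigma>) * (1 + \<sigma> * (1 - b / a)) = a powr (- \<sigma>) + \<sigma> * a powr (- \<sigma> - 1) * (a - b)"
    using a by (simp add: powr_diff field_simps)
  finally show ?thesis .
qed

text \<open>Dividing a - b by its own root, which is at least sqrt c * a^(s/2), leaves the tangent
  term of the power 1 - s/2. Square roots of decreases thereby become telescoping differences;
  \<open>s < 2\<close> keeps that power positive.\<close>

lemma sqrt_decrease_le:
  fixes a b c s :: real
  assumes "0 \<le> b" "b \<le> a" "0 < c" "1 \<le> s" "s < 2" "c * a powr s \<le> a - b"
  shows "sqrt (a - b) \<le> (a powr (1 - s / 2) - b powr (1 - s / 2)) / (sqrt c * (1 - s / 2))"
proof (cases "a = 0")
  case True
  then show ?thesis using assms by simp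
next
  case False
  then have a: "0 < a" using assms by linarith
  let ?q = "1 - s / 2"
  have q: "0 < ?q" "?q < 1" using assms by auto
  have "sqrt c * a powr (s / 2) = sqrt (c * a powr s)"
    using a by (simp add: real_sqrt_mult powr_half_sqrt[symmetric] powr_powr)
  also have "\<dots> \<le> sqrt (a - b)"
    using assms by simp
  finally have 1: "sqrt c * a powr (s / 2) \<le> sqrt (a - b)" .
  have "sqrt c * ?q * sqrt (a - b) = ?q * a powr (- (s / 2)) * ((sqrt c * a powr (s / 2)) * sqrt (a - b))"
    using a by (simp add: powr_minus)
  also have "\<dots> \<le> ?q * a powr (- (s / 2)) * (sqrt (a - b) * sqrt (a - b))"
    using q assms 1 by (intro mult_left_mono mult_right_mono) auto
  also have "\<dots> = ?q * a powr (?q - 1) * (a - b)"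
    using assms by simp
  also have "\<dots> \<le> a powr ?q - b powr ?q"
    using powr_tangent_le[OF a assms(1) q] by simp
  finally show ?thesis
    using q assms by (simp add: pos_le_divide_eq mult.commute)
qed

lemma two_step_contraction_rate:
  fixes r :: "nat \<Rightarrow> real"
  assumes nonneg: "\<And>k. 0 \<le> r k" and "0 < c"
    and step: "\<And>k. N \<le> k \<Longrightarrow> c * r k \<le> r k - r (k + 2)"
  shows "\<exists>M>0. \<exists>\<rho>\<in>{0<..<1}. \<forall>k\<ge>N. r k \<le> M * \<rho> ^ k"
proof -
  \<comment> \<open>The cap 1/2 keeps the radicand of \<rho> positive when \<open>c\<close> is 1 or
    larger; the root spreads one contraction evenly over two indices.\<close>
  define d where "d = min c (1/2)"
  define \<rho> where "\<rho> = sqrt (1 - d)"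
  \<comment> \<open>Both parity classes need an initial bound, at \<open>N\<close> and at
    \<open>N + 1\<close>; the smaller power of \<rho> serves both, and the summand 1 makes
    \<open>M\<close> positive.\<close>
  define M where "M = (r N + r (N + 1) + 1) / \<rho> ^ (N + 1)"
  have d: "0 < d" "d \<le> 1/2" "d \<le> c"
    using assms(2) by (auto simp: d_def)
  have \<rho>: "0 < \<rho>" "\<rho> < 1" "\<rho>\<^sup>2 = 1 - d"
    using d by (auto simp: \<rho>_def)
  have M: "0 < M"
    using \<rho> nonneg[of N] nonneg[of "N + 1"] by (auto simp: M_def intro!: divide_pos_pos)
  have "r k \<le> M * \<rho> ^ k" if "N \<le> k" for k
    using that
  proof (induction k rule: less_induct)
    case (less k)
    consider "k = N" | "k = N + 1" | "N + 2 \<le> k"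
      using less.prems by linarith
    then show ?case
    proof cases
      case 1
      have "r N \<le> M * \<rho> ^ (N + 1)"
        using \<rho> nonneg[of "N + 1"] by (simp add: M_def)
      also have "\<dots> \<le> M * \<rho> ^ N"
        using M \<rho> by (intro mult_left_mono power_decreasing) auto
      finally show ?thesis using 1 by simp
    next
      case 2
      then show ?thesis using \<rho> nonneg[of N] by (simp add: M_def)
    next
      case 3
      define j where "j = k - 2"
      have j: "k = j + 2" "N \<le> j" "j < k" using 3 by (auto simp: j_def)
      have "r k \<le> (1 - c) * r j"
        using step[OF j(2)] j(1) by (simp add: algebra_simps)
      also have "\<dots> \<le> \<rho>\<^sup>2 * r j"
        using d nonneg[of j] unfolding \<rho>(3) by (intro mult_right_mono) auto
      also have "\<dots> \<le> \<rho>\<^sup>2 * (M * \<rho> ^ j)"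
        using less.IH[OF j(3,2)] by (intro mult_left_mono) auto
      finally show ?thesis by (simp add: j power2_eq_square mult_ac)
    qed
  qed
  then show ?thesis using M \<rho> by (intro exI[of _ M] conjI bexI[of _ \<rho>]) auto
qed

text \<open>With \<sigma> = s - 1, the quantity r^(-\<sigma>) grows by at least c * \<sigma> over
  any two indices while r stays positive, hence at least linearly; inverting gives the rate.\<close>

lemma two_step_sublinear_rate:
  fixes r :: "nat \<Rightarrow> real"
  assumes nonneg: "\<And>k. 0 \<le> r k" and dec: "\<And>k. r (Suc k) \<le> r k" and "0 < c" "1 < s"
    and step: "\<And>k. N \<le> k \<Longrightarrow> c * r k powr s \<le> r k - r (k + 2)"
  shows "\<exists>M>0. \<forall>\<^sub>F k in sequentially. r k \<le> M * real k powr (- (1 / (s - 1)))"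
proof -
  define \<sigma> where "\<sigma> = s - 1"
  have \<sigma>: "0 < \<sigma>" using assms by (simp add: \<sigma>_def)
  \<comment> \<open>Subtracting \<open>N + 1\<close> makes the bound nonpositive at the two starting
    indices, so the induction in steps of two has trivial base cases.\<close>
  have growth: "r k powr (- \<sigma>) \<ge> c * \<sigma> / 2 * (real k - real N - 1)" if "N \<le> k" "0 < r k" for k
    using that
  proof (induction k rule: less_induct)
    case (less k)
    show ?case
    proof (cases "k \<le> N + 1")
      case True
      then have "c * \<sigma> / 2 * (real k - real N - 1) \<le> 0"
        using assms \<sigma> by (intro mult_nonneg_nonpos) auto
      then show ?thesis by (meson order_trans powr_ge_zero)
    next
      case False
      define j where "j = k - 2"
      have j: "k = j + 2" "N \<le> j" "j < k" using False by (auto simp: j_def)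
      have le: "r k \<le> r j" using dec[of j] dec[of "Suc j"] j by simp
      then have rj: "0 < r j" using less.prems by linarith
      have eq: "r j powr (- \<sigma> - 1) * r j powr s = 1"
        using rj by (simp add: \<sigma>_def flip: powr_add)
      have "c * \<sigma> = \<sigma> * r j powr (- \<sigma> - 1) * (c * r j powr s)"
        using eq by (simp add: mult_ac)
      also have "\<dots> \<le> \<sigma> * r j powr (- \<sigma> - 1) * (r j - r k)"
        using step[OF j(2)] j(1) \<sigma> by (intro mult_left_mono) auto
      also have "\<dots> \<le> r k powr (- \<sigma>) - r j powr (- \<sigma>)"
        using powr_minus_tangent_ge[OF less.prems(2) le \<sigma>] by linarith
      finally show ?thesis
        using less.IH[OF j(3,2) rj] j(1) by (simp add: algebra_simps)
    qed
  qed
  define M where "M = (c * \<sigma> / 4) powr (- (1 / \<sigma>))"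
  have "0 < M" using assms \<sigma> by (simp add: M_def)
  \<comment> \<open>From \<open>2 * N + 2\<close> on, at least half of \<open>k\<close> survives the
    shift, which turns the slope c * \<sigma> / 2 into the c * \<sigma> / 4 of
    \<open>M\<close>.\<close>
  moreover have "r k \<le> M * real k powr (- (1 / \<sigma>))" if k: "2 * N + 2 \<le> k" for k
  proof (cases "r k = 0")
    case True
    then show ?thesis using \<open>0 < M\<close> by simp
  next
    case False
    then have rk: "0 < r k" using nonneg[of k] by linarith
    have "c * \<sigma> / 4 * real k \<le> c * \<sigma> / 2 * (real k - real N - 1)"
    proof -
      have "real k / 2 \<le> real k - real N - 1"
        using k by linarith
      then have "c * \<sigma> / 2 * (real k / 2) \<le> c * \<sigma> / 2 * (real k - real N - 1)"
        using assms \<sigma> by (intro mult_left_mono) auto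
      then show ?thesis by simp
    qed
    also have "\<dots> \<le> r k powr (- \<sigma>)" using growth[of k] k rk by simp
    finally have 1: "c * \<sigma> / 4 * real k \<le> r k powr (- \<sigma>)" .
    have pos: "0 < c * \<sigma> / 4 * real k" using assms \<sigma> k by (intro mult_pos_pos) auto
    have "r k = (r k powr (- \<sigma>)) powr (- (1 / \<sigma>))"
      using rk \<sigma> by (simp add: powr_powr)
    also have "\<dots> \<le> (c * \<sigma> / 4 * real k) powr (- (1 / \<sigma>))"
      using 1 pos \<sigma> by (intro powr_mono2') auto
    also have "\<dots> = M * real k powr (- (1 / \<sigma>))"
      using assms \<sigma> by (simp add: M_def flip: powr_mult)
    finally show ?thesis .
  qed
  ultimately show ?thesis
    unfolding \<sigma>_def eventually_sequentially by blast
qed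

text \<open>The step bound is available only inside the ball, and staying inside is what has to be
  shown. Induction breaks the circle: from a start within \<epsilon> / 2, at an index where the
  whole telescoping budget is below \<epsilon> / 2, the path cannot reach the boundary.\<close>

lemma finite_length_trapping:
  fixes x :: "nat \<Rightarrow> 'a::real_normed_vector" and \<psi> :: "nat \<Rightarrow> real"
  assumes "0 < \<epsilon>" "0 < C"
    and \<psi>: "\<psi> \<longlonglongrightarrow> 0" "\<And>k. 0 \<le> \<psi> k"
    and acc: "\<And>e N. 0 < e \<Longrightarrow> \<exists>n\<ge>N. dist (x n) z < e"
    and step: "\<And>k. K \<le> k \<Longrightarrow> x k \<in> ball z \<epsilon> \<Longrightarrow> norm (x (Suc k) - x k) \<le> C * (\<psi> (k - 1) - \<psi> (Suc k))"
  shows "\<exists>N\<ge>K. \<forall>k\<ge>N. x k \<in> ball z \<epsilon>"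
proof -
  have "\<forall>\<^sub>F k in sequentially. \<psi> k < \<epsilon> / (4 * C)"
    using \<psi>(1) assms(1,2) by (auto intro: order_tendstoD)
  then obtain M where M: "\<And>k. M \<le> k \<Longrightarrow> \<psi> k < \<epsilon> / (4 * C)"
    by (auto simp: eventually_sequentially)
  \<comment> \<open>\<open>Suc\<close> guarantees that \<open>N - 1\<close> is also past
    \<open>M\<close>; the budget at \<open>N\<close> contains \<psi> at
    \<open>N - 1\<close>.\<close>
  obtain N where N: "N \<ge> Suc (max K M)" "dist (x N) z < \<epsilon> / 2"
    using acc[of "\<epsilon> / 2" "Suc (max K M)"] assms(1) by auto
  \<comment> \<open>Adding two neighbours turns the difference over two indices into an ordinary
    telescoping difference.\<close>
  define \<Psi> where "\<Psi> k = \<psi> (k - 1) + \<psi> k" for k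
  have \<Psi>: "C * \<Psi> N < \<epsilon> / 2" "\<And>k. 0 \<le> \<Psi> k"
  proof -
    have "\<Psi> N < \<epsilon> / (4 * C) + \<epsilon> / (4 * C)"
      unfolding \<Psi>_def using N(1) by (intro add_strict_mono M) auto
    then show "C * \<Psi> N < \<epsilon> / 2" using assms(2) by (simp add: field_simps)
  qed (use \<psi>(2) in \<open>auto simp: \<Psi>_def\<close>)
  have "norm (x k - x N) \<le> C * (\<Psi> N - \<Psi> k) \<and> x k \<in> ball z \<epsilon>" if "N \<le> k" for k
    using that
  proof (induction k rule: dec_induct)
    case base
    then show ?case using N assms(1) by (auto simp: dist_commute)
  next
    case (step k)
    have "norm (x (Suc k) - x k) \<le> C * (\<psi> (k - 1) - \<psi> (Suc k))"
      using step N assms by (intro assms(6)) auto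
    also have "\<dots> = C * (\<Psi> k - \<Psi> (Suc k))" by (simp add: \<Psi>_def)
    finally have "norm (x (Suc k) - x N) \<le> C * (\<Psi> k - \<Psi> (Suc k)) + C * (\<Psi> N - \<Psi> k)"
      using step.IH norm_triangle_ineq[of "x (Suc k) - x k" "x k - x N"] by simp
    then have 1: "norm (x (Suc k) - x N) \<le> C * (\<Psi> N - \<Psi> (Suc k))"
      by (simp add: algebra_simps)
    also have "\<dots> \<le> C * \<Psi> N" using assms(2) \<Psi>(2)[of "Suc k"] by (intro mult_left_mono) auto
    finally have "dist (x (Suc k)) (x N) < \<epsilon> / 2" using \<Psi>(1) by (simp add: dist_norm)
    then have "dist (x (Suc k)) z < \<epsilon>"
      using N(2) dist_triangle[of "x (Suc k)" z "x N"] by linarith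
    then show ?case using 1 by (simp add: dist_commute)
  qed
  then show ?thesis using N(1) by (intro exI[of _ N]) auto
qed

section \<open>Subdifferentials\<close>

text \<open>Clearing the denominator removes extended-real quotients; the remaining comparison
  allows \<open>h\<close> to be infinite near \<open>y\<close>.\<close>

lemma frechet_subdiff_iff:
  fixes h :: "'a::real_inner \<Rightarrow> ereal"
  assumes hy: "h y = ereal c"
  shows "d \<in> frechet_subdiff h y \<longleftrightarrow>
    (\<forall>\<epsilon>>0. \<forall>\<^sub>F z in at y. ereal (c + d \<bullet> (z - y) - \<epsilon> * norm (z - y)) \<le> h z)"
proof -
  have q: "h z - h y - ereal (d \<bullet> (z - y)) = h z - ereal (c + d \<bullet> (z - y))" for z
    unfolding hy by (cases "h z") auto
  have iff: "ereal (- \<epsilon>) < (h z - h y - ereal (d \<bullet> (z - y))) / ereal (norm (z - y)) \<longleftrightarrow>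
      ereal (c + d \<bullet> (z - y) - \<epsilon> * norm (z - y)) < h z" if "z \<noteq> y" for \<epsilon> z
    unfolding q using that
    by (cases "h z") (auto simp: field_simps)
  show ?thesis
  proof
    assume "d \<in> frechet_subdiff h y"
    then have *: "0 \<le> Liminf (at y) (\<lambda>z. (h z - h y - ereal (d \<bullet> (z - y))) / ereal (norm (z - y)))"
      by (simp add: frechet_subdiff_def)
    show "\<forall>\<epsilon>>0. \<forall>\<^sub>F z in at y. ereal (c + d \<bullet> (z - y) - \<epsilon> * norm (z - y)) \<le> h z"
    proof (intro allI impI)
      fix \<epsilon> :: real assume "0 < \<epsilon>"
      then have "ereal (- \<epsilon>) < 0" by simp
      with * have "\<forall>\<^sub>F z in at y. ereal (- \<epsilon>) < (h z - h y - ereal (d \<bullet> (z - y))) / ereal (norm (z - y))"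
        unfolding le_Liminf_iff by blast
      moreover have "\<forall>\<^sub>F z in at y. z \<noteq> y"
        by (simp add: eventually_at_filter)
      ultimately show "\<forall>\<^sub>F z in at y. ereal (c + d \<bullet> (z - y) - \<epsilon> * norm (z - y)) \<le> h z"
        by eventually_elim (use iff in \<open>auto intro: less_imp_le\<close>)
    qed
  next
    assume *: "\<forall>\<epsilon>>0. \<forall>\<^sub>F z in at y. ereal (c + d \<bullet> (z - y) - \<epsilon> * norm (z - y)) \<le> h z"
    have "\<forall>\<^sub>F z in at y. b < (h z - h y - ereal (d \<bullet> (z - y))) / ereal (norm (z - y))" if "b < 0" for b
    proof -
      obtain \<epsilon> where \<epsilon>: "0 < \<epsilon>" "b \<le> ereal (- \<epsilon>)"
      proof (cases b)
        case (real t)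
        then show ?thesis using that(1)[of "- t"] \<open>b < 0\<close> by auto
      next
        case MInf
        then show ?thesis using that(1)[of 1] by auto
      qed (use \<open>b < 0\<close> in auto)
      \<comment> \<open>Half of \<epsilon> leaves room to turn the weak inequality into the strict
        one that \<open>le_Liminf_iff\<close> demands.\<close>
      have "\<forall>\<^sub>F z in at y. ereal (c + d \<bullet> (z - y) - \<epsilon> / 2 * norm (z - y)) \<le> h z"
        using * \<epsilon>(1) half_gt_zero by blast
      moreover have "\<forall>\<^sub>F z in at y. z \<noteq> y"
        by (simp add: eventually_at_filter)
      ultimately show ?thesis
      proof eventually_elim
        case (elim z)
        have "c + d \<bullet> (z - y) - \<epsilon> * norm (z - y) < c + d \<bullet> (z - y) - \<epsilon> / 2 * norm (z - y)"
          using elim \<epsilon>(1) by simp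
        then have "ereal (c + d \<bullet> (z - y) - \<epsilon> * norm (z - y)) < h z"
          using elim(1) less_le_trans less_ereal.simps(1) by blast
        then show ?case
          using iff[OF elim(2)] \<epsilon>(2) le_less_trans by blast
      qed
    qed
    then show "d \<in> frechet_subdiff h y"
      by (auto simp: frechet_subdiff_def le_Liminf_iff edom_def hy)
  qed
qed

lemma frechet_subset_limiting_subdiff: "frechet_subdiff h y \<subseteq> limiting_subdiff h y"
proof
  fix d assume d: "d \<in> frechet_subdiff h y"
  then have "y \<in> edom h" by (simp add: frechet_subdiff_def)
  then show "d \<in> limiting_subdiff h y"
    unfolding limiting_subdiff_def
    by (intro CollectI conjI exI[of _ "\<lambda>_. y"] exI[of _ "\<lambda>_. d"]) (use d in auto)
qed

lemma has_derivative_inner_bounds: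
  fixes q :: "'a::real_inner \<Rightarrow> real"
  assumes "(q has_derivative (\<lambda>w. D \<bullet> w)) (at y)" "0 < \<epsilon>"
  shows "\<forall>\<^sub>F z in at y. \<bar>q z - q y - D \<bullet> (z - y)\<bar> \<le> \<epsilon> * norm (z - y)"
  using assms unfolding has_derivative_at_alt eventually_at
  by (auto simp: dist_norm) (metis less_imp_le)

text \<open>Fermat's rule: minimality gives h z \<ge> h w + q w - q z, and q w - q z is - D
  \<bullet> (z - w) to first order.\<close>

lemma frechet_subdiff_of_smooth_minimizer:
  fixes h :: "'a::real_inner \<Rightarrow> ereal"
  assumes min: "\<And>z. ereal (q w) + h w \<le> ereal (q z) + h z"
    and D: "(q has_derivative (\<lambda>u. D \<bullet> u)) (at w)"
    and hw: "h w = ereal c"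
  shows "- D \<in> frechet_subdiff h w"
  unfolding frechet_subdiff_iff[where h=h and y=w and c=c, OF hw]
proof (intro allI impI)
  fix \<epsilon> :: real assume "0 < \<epsilon>"
  from has_derivative_inner_bounds[OF D this]
  show "\<forall>\<^sub>F z in at w. ereal (c + - D \<bullet> (z - w) - \<epsilon> * norm (z - w)) \<le> h z"
  proof eventually_elim
    case (elim z)
    then show ?case using min[of z] unfolding hw by (cases "h z") auto
  qed
qed

text \<open>Only the first variable carries nonsmoothness, so Frechet subgradients lift to the
  product space and add up with ordinary gradients; each summand uses half of \<epsilon>.\<close>

lemma frechet_subdiff_add_smooth:
  fixes h :: "'a::real_inner \<Rightarrow> ereal" and g :: "'a \<times> 'b::real_inner \<Rightarrow> real"
  assumes d: "d \<in> frechet_subdiff h u" and hu: "h u = ereal c"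
    and D: "(g has_derivative (\<lambda>w. D \<bullet> w)) (at (u, v))"
  shows "(d, 0) + D \<in> frechet_subdiff (\<lambda>p. h (fst p) + ereal (g p)) (u, v)"
proof -
  have hu': "h (fst (u, v)) + ereal (g (u, v)) = ereal (c + g (u, v))"
    by (simp add: hu)
  show ?thesis
    unfolding frechet_subdiff_iff[of "\<lambda>p. h (fst p) + ereal (g p)", OF hu']
  proof (intro allI impI)
    fix \<epsilon> :: real assume \<epsilon>: "0 < \<epsilon>"
    have "\<forall>\<^sub>F z in at u. ereal (c + d \<bullet> (z - u) - \<epsilon> / 2 * norm (z - u)) \<le> h z"
      using d \<epsilon> half_gt_zero unfolding frechet_subdiff_iff[where h=h and y=u and c=c, OF hu] by blast
    \<comment> \<open>The punctured neighbourhood has to be filled first: \<open>p\<close> may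
      differ from \<open>(u, v)\<close> while \<open>fst p = u\<close>.\<close>
    then have "\<forall>\<^sub>F z in nhds u. ereal (c + d \<bullet> (z - u) - \<epsilon> / 2 * norm (z - u)) \<le> h z"
      by (simp add: eventually_nhds_conv_at hu)
    then have "\<forall>\<^sub>F p in at (u, v). ereal (c + d \<bullet> (fst p - u) - \<epsilon> / 2 * norm (fst p - u)) \<le> h (fst p)"
      by (rule eventually_compose_filterlim) (auto intro!: tendsto_eq_intros)
    moreover have "\<forall>\<^sub>F p in at (u, v). \<bar>g p - g (u, v) - D \<bullet> (p - (u, v))\<bar> \<le> \<epsilon> / 2 * norm (p - (u, v))"
      using has_derivative_inner_bounds[OF D] \<epsilon> half_gt_zero by blast
    ultimately show "\<forall>\<^sub>F p in at (u, v). ereal (c + g (u, v) + ((d, 0) + D) \<bullet> (p - (u, v))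
        - \<epsilon> * norm (p - (u, v))) \<le> h (fst p) + ereal (g p)"
    proof eventually_elim
      case (elim p)
      have "norm (fst p - u) \<le> norm (p - (u, v))"
        using norm_fst_le[of "fst p - u" "snd p - v"] by (cases p) simp
      then have "\<epsilon> / 2 * norm (fst p - u) \<le> \<epsilon> / 2 * norm (p - (u, v))"
        using \<epsilon> by (intro mult_left_mono) auto
      moreover have "((d, 0) + D) \<bullet> (p - (u, v)) = d \<bullet> (fst p - u) + D \<bullet> (p - (u, v))"
        by (cases p) (simp add: inner_add_left)
      moreover have "g (u, v) + D \<bullet> (p - (u, v)) - \<epsilon> / 2 * norm (p - (u, v)) \<le> g p"
        using elim(2) by linarith
      ultimately have "c + g (u, v) + ((d, 0) + D) \<bullet> (p - (u, v)) - \<epsilon> * norm (p - (u, v))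
          \<le> (c + d \<bullet> (fst p - u) - \<epsilon> / 2 * norm (fst p - u)) + g p"
        by linarith
      then have "ereal (c + g (u, v) + ((d, 0) + D) \<bullet> (p - (u, v)) - \<epsilon> * norm (p - (u, v)))
          \<le> ereal (c + d \<bullet> (fst p - u) - \<epsilon> / 2 * norm (fst p - u)) + ereal (g p)"
        by simp
      also have "\<dots> \<le> h (fst p) + ereal (g p)"
        using elim(1) by (rule add_right_mono)
      finally show ?case .
    qed
  qed
qed

section \<open>Convex subgradients and gradients\<close>

lemma convex_frechet_subgradient:
  fixes P :: "'a::real_inner \<Rightarrow> real"
  assumes "convex_on UNIV P" "d \<in> frechet_subdiff (\<lambda>u. ereal (P u)) y"
  shows "P y + d \<bullet> (z - y) \<le> P z"
proof (cases "z = y")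
  case False
  show ?thesis
  proof (rule field_le_epsilon)
    fix e :: real assume e: "0 < e"
    \<comment> \<open>Along the segment to \<open>z\<close> the error at parameter t is then t * e,
      so dividing by t leaves \<open>e\<close>; convexity carries the local inequality to
      \<open>z\<close> itself.\<close>
    define \<epsilon> where "\<epsilon> = e / norm (z - y)"
    have \<epsilon>: "0 < \<epsilon>" using e False by (simp add: \<epsilon>_def)
    then have "\<forall>\<^sub>F w in at y. P y + d \<bullet> (w - y) - \<epsilon> * norm (w - y) \<le> P w"
      using assms(2) by (simp add: frechet_subdiff_iff)
    then have "\<forall>\<^sub>F w in nhds y. P y + d \<bullet> (w - y) - \<epsilon> * norm (w - y) \<le> P w"
      by (simp add: eventually_nhds_conv_at)
    moreover have "((\<lambda>t. y + t *\<^sub>R (z - y)) \<longlongrightarrow> y) (at_right 0)"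
      by (auto intro!: tendsto_eq_intros)
    ultimately have "\<forall>\<^sub>F t in at_right 0. P y + d \<bullet> ((y + t *\<^sub>R (z - y)) - y)
        - \<epsilon> * norm ((y + t *\<^sub>R (z - y)) - y) \<le> P (y + t *\<^sub>R (z - y))"
      by (rule eventually_compose_filterlim)
    moreover have "\<forall>\<^sub>F t in at_right (0::real). 0 < t \<and> t < 1"
      by (auto simp: eventually_at_right_field intro!: exI[of _ 1])
    ultimately obtain t where t: "0 < t" "t < 1" "P y + d \<bullet> ((y + t *\<^sub>R (z - y)) - y)
        - \<epsilon> * norm ((y + t *\<^sub>R (z - y)) - y) \<le> P (y + t *\<^sub>R (z - y))"
      using eventually_happens'[OF trivial_limit_at_right_real eventually_conj] by blast
    have "P (y + t *\<^sub>R (z - y)) = P ((1 - t) *\<^sub>R y + t *\<^sub>R z)"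
        by (simp add: algebra_simps)
      also have "\<dots> \<le> (1 - t) * P y + t * P z"
        using t by (intro convex_onD[OF assms(1)]) auto
      finally have "P (y + t *\<^sub>R (z - y)) \<le> (1 - t) * P y + t * P z" .
      moreover have "P y + t * (d \<bullet> (z - y)) - \<epsilon> * (t * norm (z - y)) \<le> P (y + t *\<^sub>R (z - y))"
        using t by simp
      ultimately have "t * (P y + d \<bullet> (z - y)) \<le> t * (P z + \<epsilon> * norm (z - y))"
        unfolding ring_distribs by (simp add: mult.left_commute)
      then show "P y + d \<bullet> (z - y) \<le> P z + e" using t False by (simp add: \<epsilon>_def)
  qed
qed simp

text \<open>The subgradient inequality is stable under limits, and conversely it is a Frechet
  inequality without error term; so taking limits adds nothing for finite convex functions.\<close>

lemma limiting_subdiff_convex_iff: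
  fixes P :: "'a::euclidean_space \<Rightarrow> real"
  assumes "convex_on UNIV P"
  shows "d \<in> limiting_subdiff (\<lambda>u. ereal (P u)) y \<longleftrightarrow> (\<forall>z. P y + d \<bullet> (z - y) \<le> P z)"
proof
  assume "d \<in> limiting_subdiff (\<lambda>u. ereal (P u)) y"
  then obtain u v where uv: "u \<longlonglongrightarrow> y" "(\<lambda>k. P (u k)) \<longlonglongrightarrow> P y" "v \<longlonglongrightarrow> d"
    "\<And>k. v k \<in> frechet_subdiff (\<lambda>u. ereal (P u)) (u k)"
    by (auto simp: limiting_subdiff_def)
  show "\<forall>z. P y + d \<bullet> (z - y) \<le> P z"
  proof
    fix z
    show "P y + d \<bullet> (z - y) \<le> P z"
    proof (rule LIMSEQ_le_const2)
      show "(\<lambda>k. P (u k) + v k \<bullet> (z - u k)) \<longlonglongrightarrow> P y + d \<bullet> (z - y)"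
        using uv by (intro tendsto_intros)
    qed (use convex_frechet_subgradient[OF assms uv(4)] in auto)
  qed
next
  assume *: "\<forall>z. P y + d \<bullet> (z - y) \<le> P z"
  have "d \<in> frechet_subdiff (\<lambda>u. ereal (P u)) y"
    unfolding frechet_subdiff_iff[of "\<lambda>u. ereal (P u)", OF refl]
  proof (intro allI impI always_eventually)
    fix \<epsilon> :: real and z assume "0 < \<epsilon>"
    then have "0 \<le> \<epsilon> * norm (z - y)" by simp
    then show "ereal (P y + d \<bullet> (z - y) - \<epsilon> * norm (z - y)) \<le> ereal (P z)"
      using *[rule_format, of z] by simp
  qed
  then show "d \<in> limiting_subdiff (\<lambda>u. ereal (P u)) y"
    using frechet_subset_limiting_subdiff by blast
qed

lemma has_derivative_grad:
  fixes f :: "'a::euclidean_space \<Rightarrow> real"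
  assumes "f differentiable (at y)"
  shows "(f has_derivative (\<lambda>w. grad f y \<bullet> w)) (at y)"
proof -
  obtain f' where f': "(f has_derivative f') (at y)"
    using assms by (auto simp: differentiable_def)
  \<comment> \<open>The Riesz representer of the derivative, in coordinates; its uniqueness below
    identifies it with the definite description in \<open>grad\<close>.\<close>
  define D where "D = (\<Sum>b\<in>Basis. f' b *\<^sub>R b)"
  have "f' = (\<lambda>w. w \<bullet> D)"
  proof
    fix w
    interpret f': bounded_linear f' using f' by (rule has_derivative_bounded_linear)
    have "f' w = f' (\<Sum>b\<in>Basis. (w \<bullet> b) *\<^sub>R b)" by (simp add: euclidean_representation)
    also have "\<dots> = w \<bullet> D" 
      unfolding D_def f'.sum by (simp add: f'.scaleR inner_sum_right mult.commute)
    finally show "f' w = w \<bullet> D" .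
  qed
  then have D: "GDERIV f y :> D" using f' by (simp add: gderiv_def)
  have "D' = D" if "GDERIV f y :> D'" for D'
  proof -
    have "(\<lambda>w. w \<bullet> D') = (\<lambda>w. w \<bullet> D)"
      using that D has_derivative_unique unfolding gderiv_def by blast
    then have "w \<bullet> (D' - D) = 0" for w by (metis inner_diff_right right_minus_eq)
    then show ?thesis using inner_eq_zero_iff[of "D' - D"] by simp
  qed
  then have "grad f y = D" unfolding grad_def using D by blast
  then show ?thesis using D by (simp add: gderiv_def inner_commute)
qed

text \<open>\<open>P\<close> minus the supporting affine function is minimal at \<open>y\<close>, so
  its derivative vanishes. This turns the chosen subgradients \<xi> into gradients wherever
  \<open>P2\<close> is smooth.\<close>

lemma convex_subgradient_eq_grad:
  fixes P :: "'a::euclidean_space \<Rightarrow> real"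
  assumes "\<And>z. P y + d \<bullet> (z - y) \<le> P z" "P differentiable (at y)"
  shows "d = grad P y"
proof -
  have "((\<lambda>z. P z - d \<bullet> (z - y)) has_derivative (\<lambda>w. grad P y \<bullet> w - d \<bullet> w)) (at y)"
    using has_derivative_grad[OF assms(2)]
    by (auto intro!: derivative_eq_intros)
  then have "(\<lambda>w. grad P y \<bullet> w - d \<bullet> w) = (\<lambda>w. 0)"
    by (rule differential_zero_maxmin[OF _ open_UNIV, rotated])
       (use assms(1) in \<open>auto simp: algebra_simps\<close>)
  then have "(grad P y - d) \<bullet> (grad P y - d) = 0"
    by (metis inner_diff_left)
  then show ?thesis by simp
qed

text \<open>Testing the subgradient inequality one unit along \<open>d\<close> bounds its norm by an
  oscillation of \<open>P\<close>, which is finite on a ball of radius enlarged by 1.\<close>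

lemma convex_subgradients_bounded:
  fixes P :: "'a::euclidean_space \<Rightarrow> real"
  assumes "convex_on UNIV P"
  shows "\<exists>M. \<forall>y\<in>cball a \<rho>. \<forall>d. (\<forall>z. P y + d \<bullet> (z - y) \<le> P z) \<longrightarrow> norm d \<le> M"
proof -
  have "continuous_on (cball a (\<rho> + 1)) P"
    using convex_on_continuous[OF open_UNIV assms] continuous_on_subset by blast
  then have "bounded (P ` cball a (\<rho> + 1))"
    by (intro compact_imp_bounded compact_continuous_image) auto
  then obtain B where B: "\<And>y. y \<in> cball a (\<rho> + 1) \<Longrightarrow> \<bar>P y\<bar> \<le> B"
    unfolding bounded_iff by (metis imageI real_norm_def)
  have "norm d \<le> 2 * B" if "y \<in> cball a \<rho>" "\<forall>z. P y + d \<bullet> (z - y) \<le> P z" for y d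
  proof -
    have "d \<bullet> sgn d = norm d"
      by (cases "d = 0") (auto simp: sgn_div_norm dot_square_norm power2_eq_square)
    then have "P y + norm d \<le> P (y + sgn d)"
      using that(2)[rule_format, of "y + sgn d"] by simp
    moreover have "dist a (y + sgn d) \<le> \<rho> + 1"
    proof -
      have "dist y (y + sgn d) \<le> 1" by (simp add: dist_norm norm_sgn)
      then show ?thesis using that(1) dist_triangle[of a "y + sgn d" y] by simp
    qed
    ultimately show ?thesis using B[of y] B[of "y + sgn d"] that(1) by auto
  qed
  then show ?thesis by blast
qed

section \<open>Lower semicontinuity and attainment of minima\<close>

lemma closed_fun_le_of_tendsto:
  fixes h :: "'a::t1_space \<Rightarrow> ereal"
  assumes "closed_fun h" "u \<longlonglongrightarrow> y" "c \<longlonglongrightarrow> c0" "\<forall>\<^sub>F k in sequentially. h (u k) \<le> c k"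
  shows "h y \<le> c0"
proof (rule dense_le)
  fix b assume b: "b < h y"
  then have "\<forall>\<^sub>F z in at y. b < h z"
    using assms(1) unfolding closed_fun_def le_Liminf_iff by blast
  \<comment> \<open>The lower limit in \<open>closed_fun\<close> ignores the point itself;
    \<open>b < h y\<close> supplies it.\<close>
  then have "\<forall>\<^sub>F z in nhds y. b < h z"
    using b by (simp add: eventually_nhds_conv_at)
  then have "\<forall>\<^sub>F k in sequentially. b < h (u k)"
    using assms(2) by (rule eventually_compose_filterlim)
  with assms(4) have "\<forall>\<^sub>F k in sequentially. b \<le> c k"
    by eventually_elim auto
  then show "b \<le> c0"
    using assms(3) by (intro tendsto_lowerbound[OF assms(3)]) auto
qed

text \<open>Direct method with one bounded sublevel set: either \<open>y\<close> already attains the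
  infimum, or a minimizing sequence ends up in that set and has a convergent subsequence.\<close>

lemma closed_fun_attains_min:
  fixes h :: "'a::euclidean_space \<Rightarrow> ereal"
  assumes "closed_fun h" "bounded {z. h z \<le> h y}"
  shows "\<exists>w. \<forall>z. h w \<le> h z"
proof -
  define I where "I = Inf (range h)"
  have "\<exists>c. (\<forall>n. c n \<in> range h) \<and> c \<longlonglongrightarrow> I"
    unfolding I_def by (rule Inf_as_limit) simp
  then obtain c where c: "\<And>n. c n \<in> range h" "c \<longlonglongrightarrow> I"
    by blast
  show ?thesis
  proof (cases "I < h y")
    case True
    have "\<forall>n. \<exists>v. c n = h v" using c(1) by blast
    from choice[OF this] obtain u where u: "\<And>n. c n = h (u n)" by blast
    have "\<forall>\<^sub>F n in sequentially. h (u n) < h y"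
      using order_tendstoD(2)[OF c(2) True] by (simp add: u)
    then obtain N where N: "\<And>n. N \<le> n \<Longrightarrow> h (u n) < h y"
      by (auto simp: eventually_sequentially)
    have "range (\<lambda>n. u (n + N)) \<subseteq> {z. h z \<le> h y}"
    proof clarify
      fix n show "h (u (n + N)) \<le> h y" by (rule less_imp_le, rule N) simp
    qed
    then have "bounded (range (\<lambda>n. u (n + N)))"
      by (rule bounded_subset[OF assms(2)])
    from bounded_imp_convergent_subsequence[OF this]
    obtain w r where wr: "strict_mono r" "((\<lambda>n. u (n + N)) \<circ> r) \<longlonglongrightarrow> w"
      by blast
    have "filterlim (\<lambda>n. r n + N) sequentially sequentially"
      by (rule filterlim_compose[OF filterlim_add_const_nat_at_top filterlim_subseq[OF wr(1)]])
    then have "(\<lambda>n. c (r n + N)) \<longlonglongrightarrow> I"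
      by (rule filterlim_compose[OF c(2)])
    then have "h w \<le> I"
      using wr(2) by (intro closed_fun_le_of_tendsto[OF assms(1)]) (auto simp: o_def u)
    then have "h w \<le> h z" for z
      unfolding I_def by (rule order_trans) (simp add: Inf_lower)
    then show ?thesis by blast
  next
    case False
    then have "h y \<le> I" by simp
    then have "h y \<le> h z" for z
      unfolding I_def by (rule order_trans) (simp add: Inf_lower)
    then show ?thesis by blast
  qed
qed

section \<open>Lipschitz estimates and quadratic minorants\<close>

lemma locally_lipschitz_imp_lipschitz_cball:
  fixes g :: "'a::euclidean_space \<Rightarrow> 'b::metric_space"
  assumes "locally_lipschitz_on UNIV g"
  shows "\<exists>L>0. L-lipschitz_on (cball a \<rho>) g"
proof -
  \<comment> \<open>A dummy time set with one element gives access to the compactness result for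
    time-dependent vector fields.\<close>
  have "local_lipschitz {0::real} (cball a \<rho>) (\<lambda>_. g)"
    unfolding local_lipschitz_def
  proof (intro ballI)
    fix y t assume "y \<in> cball a \<rho>" "t \<in> {0::real}"
    obtain r L where rL: "0 < r" "L-lipschitz_on (ball y r) g"
      using assms unfolding locally_lipschitz_on_def by (metis UNIV_I inf_top.right_neutral)
    then have "L-lipschitz_on (cball y (r / 2) \<inter> cball a \<rho>) g"
      by (auto intro: lipschitz_on_subset)
    then show "\<exists>u>0. \<exists>L. \<forall>t\<in>cball t u \<inter> {0}. L-lipschitz_on (cball y u \<inter> cball a \<rho>) g"
      using rL(1) half_gt_zero by blast
  qed
  then obtain L where "L-lipschitz_on (cball a \<rho>) g"
    using local_lipschitz_compact_implies_lipschitz[of "{0::real}" "cball a \<rho>" "\<lambda>_. g" thesis]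
    by simp
  then have "(\<bar>L\<bar> + 1)-lipschitz_on (cball a \<rho>) g"
    by (rule lipschitz_on_le) auto
  then show ?thesis by (intro exI[of _ "\<bar>L\<bar> + 1"]) auto
qed

text \<open>The slope is taken at a third point \<open>y\<close>, since the subproblem linearizes
  \<open>f\<close> at the extrapolated point; the mean value point is within |w - u| + |u - y| of
  it.\<close>

lemma increment_le_grad_lipschitz:
  fixes f :: "'a::euclidean_space \<Rightarrow> real"
  assumes diff: "\<And>z. f differentiable (at z)" and L: "L-lipschitz_on S (grad f)"
    and S: "convex S" "u \<in> S" "w \<in> S" "y \<in> S"
  shows "f w - f u - grad f y \<bullet> (w - u) \<le> L * (norm (w - u) + norm (u - y)) * norm (w - u)"
proof -
  have "\<exists>t\<in>{0<..<1}. f (u + 1 *\<^sub>R (w - u)) - f (u + 0 *\<^sub>R (w - u))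
      = (\<lambda>s. s * (grad f (u + t *\<^sub>R (w - u)) \<bullet> (w - u))) (1 - 0)"
  proof (rule mvt_simple)
    fix t :: real
    have "((\<lambda>t. u + t *\<^sub>R (w - u)) has_derivative (\<lambda>s. s *\<^sub>R (w - u))) (at t within {0..1})"
      by (auto intro!: derivative_eq_intros)
    from has_derivative_compose[OF this has_derivative_grad[OF diff]]
    show "((\<lambda>t. f (u + t *\<^sub>R (w - u))) has_derivative
        (\<lambda>s. s * (grad f (u + t *\<^sub>R (w - u)) \<bullet> (w - u)))) (at t within {0..1})"
      by simp
  qed simp
  then obtain t where t: "0 < t" "t < 1"
    and eq: "f w - f u = grad f (u + t *\<^sub>R (w - u)) \<bullet> (w - u)" by auto
  let ?z = "u + t *\<^sub>R (w - u)"
  have "?z = (1 - t) *\<^sub>R u + t *\<^sub>R w" by (simp add: algebra_simps)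
  then have z: "?z \<in> S" using S t by (auto simp: convex_alt)
  have "f w - f u - grad f y \<bullet> (w - u) = (grad f ?z - grad f y) \<bullet> (w - u)"
    by (simp add: eq inner_diff_left)
  also have "\<dots> \<le> norm (grad f ?z - grad f y) * norm (w - u)" by (rule norm_cauchy_schwarz)
  also have "\<dots> \<le> L * norm (?z - y) * norm (w - u)"
    using lipschitz_on_normD[OF L z S(4)] by (intro mult_right_mono) auto
  also have "\<dots> \<le> L * (norm (w - u) + norm (u - y)) * norm (w - u)"
  proof (intro mult_right_mono mult_left_mono)
    have "norm (?z - y) \<le> norm (t *\<^sub>R (w - u)) + norm (u - y)"
      using norm_triangle_ineq[of "t *\<^sub>R (w - u)" "u - y"] by (simp add: algebra_simps)
    also have "norm (t *\<^sub>R (w - u)) \<le> norm (w - u)" using t by (simp add: mult_left_le_one_le)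
    finally show "norm (?z - y) \<le> norm (w - u) + norm (u - y)" by simp
  qed (use lipschitz_on_nonneg[OF L] in auto)
  finally show ?thesis .
qed

lemma prox_bounded_lower_bound:
  assumes "prox_bounded h"
  shows "\<exists>\<mu>>0. \<exists>C::real. \<forall>z. ereal (C - \<mu> / 2 * (norm z)\<^sup>2) \<le> h z"
proof -
  obtain \<mu> where \<mu>: "0 < \<mu>" "(INF z. h z + ereal (\<mu> / 2 * (norm z)\<^sup>2)) > -\<infinity>"
    using assms unfolding prox_bounded_def by blast
  \<comment> \<open>Strictly below the infimum, because the infimum may be infinite.\<close>
  obtain C :: real where C: "ereal C < (INF z. h z + ereal (\<mu> / 2 * (norm z)\<^sup>2))"
    using ereal_dense2[OF \<mu>(2)] by blast
  have "ereal (C - \<mu> / 2 * (norm z)\<^sup>2) \<le> h z" for z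
  proof -
    have "ereal C < h z + ereal (\<mu> / 2 * (norm z)\<^sup>2)"
      using less_INF_D[OF C, of z] by simp
    then show ?thesis by (cases "h z") auto
  qed
  then show ?thesis using \<mu>(1) by blast
qed

section \<open>The potential function and the KL inequality\<close>

text \<open>Separates the only nonsmooth candidate \<open>P1\<close> from a real-valued function of
  all three variables, as the sum rule needs; the squared norm becomes an inner product to suit the
  derivative rules.\<close>

lemma potential_objective_eq:
  "potential \<delta> (objective f P1 P2) = (\<lambda>p. P1 (fst p) +
     ereal (f (fst p) - P2 (fst p) + \<delta> * snd (snd p) / 8 * ((fst p - fst (snd p)) \<bullet> (fst p - fst (snd p)))))"
proof
  fix p :: "'a \<times> 'a \<times> real"
  show "potential \<delta> (objective f P1 P2) p = P1 (fst p) +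
     ereal (f (fst p) - P2 (fst p) + \<delta> * snd (snd p) / 8 * ((fst p - fst (snd p)) \<bullet> (fst p - fst (snd p))))"
    by (cases p; cases "P1 (fst p)")
       (auto simp: potential_def objective_def power2_norm_eq_inner)
qed

text \<open>The three components belong to \<open>u\<close>, \<open>v\<close> and \<gamma>. The last
  one, the \<gamma>-derivative, is quadratic in |u - v|.\<close>

lemma frechet_subdiff_potential:
  fixes f P2 :: "'a::euclidean_space \<Rightarrow> real"
  assumes d: "d \<in> frechet_subdiff P1 u" and u: "P1 u = ereal c"
    and diff: "f differentiable (at u)" "P2 differentiable (at u)"
  shows "(d + grad f u - grad P2 u + (\<delta> * \<gamma> / 4) *\<^sub>R (u - v), - ((\<delta> * \<gamma> / 4) *\<^sub>R (u - v)),
      \<delta> / 8 * (norm (u - v))\<^sup>2) \<in> frechet_subdiff (potential \<delta> (objective f P1 P2)) (u, v, \<gamma>)"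
proof -
  define D where "D = (grad f u - grad P2 u + (\<delta> * \<gamma> / 4) *\<^sub>R (u - v),
    - ((\<delta> * \<gamma> / 4) *\<^sub>R (u - v)), \<delta> / 8 * (norm (u - v))\<^sup>2)"
  have f: "((\<lambda>p. f (fst p)) has_derivative (\<lambda>w. grad f u \<bullet> fst w)) (at (u, v, \<gamma>))"
    by (rule has_derivative_compose[of fst fst _ _ f])
       (auto intro!: derivative_eq_intros has_derivative_grad[OF diff(1)])
  have P2: "((\<lambda>p. P2 (fst p)) has_derivative (\<lambda>w. grad P2 u \<bullet> fst w)) (at (u, v, \<gamma>))"
    by (rule has_derivative_compose[of fst fst _ _ P2])
       (auto intro!: derivative_eq_intros has_derivative_grad[OF diff(2)])
  have s: "((\<lambda>p. \<delta> * snd (snd p) / 8) has_derivative (\<lambda>w. \<delta> * snd (snd w) / 8)) (at (u, v, \<gamma>))"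
    by (auto intro!: derivative_eq_intros)
  have e: "((\<lambda>p. fst p - fst (snd p)) has_derivative (\<lambda>w. fst w - fst (snd w))) (at (u, v, \<gamma>))"
    by (auto intro!: derivative_eq_intros)
  have "((\<lambda>p. f (fst p) - P2 (fst p) + \<delta> * snd (snd p) / 8 *
      ((fst p - fst (snd p)) \<bullet> (fst p - fst (snd p)))) has_derivative (\<lambda>w. D \<bullet> w)) (at (u, v, \<gamma>))"
    by (rule has_derivative_eq_rhs[OF has_derivative_add[OF has_derivative_diff[OF f P2]
          has_derivative_mult[OF s has_derivative_inner[OF e e]]]])
       (auto simp: D_def fun_eq_iff inner_add_left inner_diff_left inner_diff_right
         inner_add_right power2_norm_eq_inner inner_commute algebra_simps)
  from frechet_subdiff_add_smooth[OF d u this]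
  show ?thesis
    unfolding potential_objective_eq D_def by (simp add: algebra_simps)
qed

text \<open>The KL hypothesis speaks only about points with nonempty subdifferential; this provides
  them, for every \<gamma>, on the diagonal over a point where \<open>P1\<close> has a limiting
  subgradient.\<close>

lemma limiting_subdiff_potential_nonempty:
  fixes f P2 :: "'a::euclidean_space \<Rightarrow> real"
  assumes P1: "\<And>u. P1 u \<noteq> -\<infinity>" and d: "d \<in> limiting_subdiff P1 z"
    and f: "continuously_differentiable_on UNIV f"
    and S: "open S" "z \<in> S" "continuously_differentiable_on S P2"
  shows "limiting_subdiff (potential \<delta> (objective f P1 P2)) (z, z, \<gamma>) \<noteq> {}"
proof -
  obtain u v where uv: "u \<longlonglongrightarrow> z" "(\<lambda>k. P1 (u k)) \<longlonglongrightarrow> P1 z" "v \<longlonglongrightarrow> d"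
    "\<And>k. v k \<in> frechet_subdiff P1 (u k)" and z: "z \<in> edom P1"
    using d by (auto simp: limiting_subdiff_def)
  obtain N where N: "\<And>k. N \<le> k \<Longrightarrow> u k \<in> S"
    using topological_tendstoD[OF uv(1) S(1,2)] by (auto simp: eventually_sequentially)
  \<comment> \<open>Dropping initial terms puts the whole sequence into \<open>S\<close>, where
    \<open>P2\<close> has gradients.\<close>
  define u' v' where "u' k = u (k + N)" and "v' k = v (k + N)" for k
  have u': "u' \<longlonglongrightarrow> z" "(\<lambda>k. P1 (u' k)) \<longlonglongrightarrow> P1 z" "v' \<longlonglongrightarrow> d"
    unfolding u'_def v'_def by (intro LIMSEQ_ignore_initial_segment uv)+
  have fin: "P1 (u' k) = ereal (real_of_ereal (P1 (u' k)))" for k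
    using P1[of "u' k"] uv(4)[of "k + N"] by (cases "P1 (u' k)") (auto simp: frechet_subdiff_def edom_def u'_def)
  have contP2: "isCont P2 z" and contf: "isCont f z"
    using S f by (auto simp: continuously_differentiable_on_def intro: differentiable_imp_continuous_within)
  have gf: "isCont (grad f) z" and gP2: "isCont (grad P2) z"
    using f S continuous_on_eq_continuous_at by (auto simp: continuously_differentiable_on_def)
  let ?H = "potential \<delta> (objective f P1 P2)"
  define D where "D k = (v' k + grad f (u' k) - grad P2 (u' k) + (\<delta> * \<gamma> / 4) *\<^sub>R (u' k - z),
    - ((\<delta> * \<gamma> / 4) *\<^sub>R (u' k - z)), \<delta> / 8 * (norm (u' k - z))\<^sup>2)" for k
  have "D k \<in> frechet_subdiff ?H (u' k, z, \<gamma>)" for k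
    unfolding D_def
  proof (rule frechet_subdiff_potential)
    show "v' k \<in> frechet_subdiff P1 (u' k)" using uv(4) by (simp add: u'_def v'_def)
    show "f differentiable at (u' k)" using f by (simp add: continuously_differentiable_on_def)
    show "P2 differentiable at (u' k)"
      using S(3) N[of "k + N"] by (auto simp: continuously_differentiable_on_def u'_def)
  qed (rule fin)
  moreover have "D \<longlonglongrightarrow> (d + grad f z - grad P2 z + (\<delta> * \<gamma> / 4) *\<^sub>R (z - z),
    - ((\<delta> * \<gamma> / 4) *\<^sub>R (z - z)), \<delta> / 8 * (norm (z - z))\<^sup>2)"
    unfolding D_def
    by (intro tendsto_intros u' isCont_tendsto_compose[OF gf u'(1)] isCont_tendsto_compose[OF gP2 u'(1)])
  moreover have "(\<lambda>k. ?H (u' k, z, \<gamma>)) \<longlonglongrightarrow> ?H (z, z, \<gamma>)"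
    unfolding potential_objective_eq fst_conv snd_conv
    by (intro tendsto_add_ereal_general u'(2) tendsto_intros
        isCont_tendsto_compose[OF contf u'(1)] isCont_tendsto_compose[OF contP2 u'(1)] u'(1))
       (use P1 in auto)
  moreover have "(\<lambda>k. (u' k, z, \<gamma>)) \<longlonglongrightarrow> (z, z, \<gamma>)"
    by (intro tendsto_intros u')
  moreover have "(z, z, \<gamma>) \<in> edom ?H"
    using z by (auto simp: edom_def potential_objective_eq)
  ultimately show ?thesis
    unfolding limiting_subdiff_def by blast
qed

text \<open>Inserting \<phi>' = a * (1 - \<theta>) * t^(-\<theta>) makes the inequality explicit.
  The distance is at most the norm of any particular subgradient, and one subgradient is what the
  algorithm supplies.\<close>

lemma KL_at_with_exponent_inequality:
  fixes H :: "'a::real_inner \<Rightarrow> ereal"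
  assumes KL: "KL_at_with_exponent H \<theta> z" and z: "H z = ereal \<zeta>" and \<theta>: "\<theta> < 1"
  shows "\<exists>\<nu>>0. \<exists>c>0. \<exists>\<epsilon>>0. \<forall>w\<in>ball z \<epsilon>. \<forall>h D. H w = ereal h \<longrightarrow> \<zeta> < h \<longrightarrow> h < \<zeta> + \<nu> \<longrightarrow>
    D \<in> limiting_subdiff H w \<longrightarrow> c * (h - \<zeta>) powr \<theta> \<le> norm D"
proof -
  obtain \<nu> :: ereal and V \<phi> a where KL: "0 < \<nu>" "open V" "z \<in> V" "0 < a"
    "\<And>t. 0 \<le> t \<Longrightarrow> ereal t < \<nu> \<Longrightarrow> \<phi> t = a * t powr (1 - \<theta>)"
    "\<And>w. w \<in> V \<Longrightarrow> H z < H w \<Longrightarrow> H w < H z + \<nu> \<Longrightarrow>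
       1 \<le> ereal (deriv \<phi> (real_of_ereal (H w - H z))) * dist0 (limiting_subdiff H w)"
    using KL unfolding KL_at_with_exponent_def by blast
  \<comment> \<open>A finite positive range inside \<nu>, which may be infinite.\<close>
  obtain n where n: "0 < n" "ereal n \<le> \<nu>"
    using ereal_dense2[OF KL(1)] by (auto intro: less_imp_le)
  obtain \<epsilon> where \<epsilon>: "0 < \<epsilon>" "ball z \<epsilon> \<subseteq> V"
    using KL(2,3) open_contains_ball by blast
  define c where "c = 1 / (a * (1 - \<theta>))"
  have c: "0 < c" using KL(4) \<theta> by (simp add: c_def)
  have "c * (h - \<zeta>) powr \<theta> \<le> norm D"
    if w: "w \<in> ball z \<epsilon>" "H w = ereal h" "\<zeta> < h" "h < \<zeta> + n" "D \<in> limiting_subdiff H w" for w h D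
  proof -
    define t where "t = h - \<zeta>"
    have t: "0 < t" "t < n" using w by (auto simp: t_def)
    have "(\<phi> has_field_derivative a * ((1 - \<theta>) * t powr (- \<theta>))) (at t)"
    proof (rule has_field_derivative_transform_within_open)
      show "((\<lambda>t. a * t powr (1 - \<theta>)) has_field_derivative a * ((1 - \<theta>) * t powr (- \<theta>))) (at t)"
        using t by (auto intro!: derivative_eq_intros)
      show "\<And>s. s \<in> {0<..<n} \<Longrightarrow> a * s powr (1 - \<theta>) = \<phi> s"
        using KL(5) n(2) by (metis greaterThanLessThan_iff less_ereal.simps(1) less_imp_le less_le_trans)
    qed (use t in auto)
    then have deriv: "deriv \<phi> t = a * (1 - \<theta>) * t powr (- \<theta>)"
      by (simp add: DERIV_imp_deriv mult.assoc)
    have "H w < H z + \<nu>"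
    proof -
      have "H w < H z + ereal n" using w z by simp
      also have "\<dots> \<le> H z + \<nu>" using n(2) by (rule add_left_mono)
      finally show ?thesis .
    qed
    then have "1 \<le> ereal (deriv \<phi> t) * dist0 (limiting_subdiff H w)"
      using KL(6)[of w] w \<epsilon>(2) z by (auto simp: t_def)
    also have "\<dots> \<le> ereal (deriv \<phi> t) * ereal (norm D)"
      unfolding dist0_def using w(5) KL(4) \<theta> by (intro ereal_mult_left_mono INF_lower) (auto simp: deriv)
    finally have "1 \<le> deriv \<phi> t * norm D" by simp
    then have "t powr \<theta> * 1 \<le> t powr \<theta> * (a * (1 - \<theta>) * t powr (- \<theta>) * norm D)"
      unfolding deriv by (rule mult_left_mono) simp
    also have "\<dots> = a * (1 - \<theta>) * norm D"
      using t by (simp add: powr_minus)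
    finally show ?thesis
      unfolding c_def t_def[symmetric] using KL(4) \<theta> by (simp add: divide_le_eq mult.commute)
  qed
  then show ?thesis using n(1) c \<epsilon>(1) by blast
qed

text \<open>A fixed exponent lets the KL inequalities at the points \<open>(z, z, \<gamma>)\<close> be merged over the
  compact range of \<open>\<gamma>\<close>, although the accepted proximal parameters need not converge.\<close>

lemma KL_inequality_uniform:
  fixes H :: "'a::euclidean_space \<times> 'a \<times> real \<Rightarrow> ereal"
  assumes KL: "\<And>\<gamma>. lo \<le> \<gamma> \<Longrightarrow> \<gamma> \<le> hi \<Longrightarrow> KL_at_with_exponent H \<theta> (z, z, \<gamma>)"
    and z: "\<And>\<gamma>. H (z, z, \<gamma>) = ereal \<zeta>" and \<theta>: "\<theta> < 1" and "lo \<le> hi"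
  shows "\<exists>\<nu>>0. \<exists>c>0. \<exists>\<epsilon>>0. \<forall>u\<in>ball z \<epsilon>. \<forall>v\<in>ball z \<epsilon>. \<forall>\<gamma>\<in>{lo..hi}. \<forall>h D.
    H (u, v, \<gamma>) = ereal h \<longrightarrow> \<zeta> < h \<longrightarrow> h < \<zeta> + \<nu> \<longrightarrow>
    D \<in> limiting_subdiff H (u, v, \<gamma>) \<longrightarrow> c * (h - \<zeta>) powr \<theta> \<le> norm D"
proof -
  define Q where "Q \<nu> c \<epsilon> a b \<longleftrightarrow> (\<forall>u\<in>ball z \<epsilon>. \<forall>v\<in>ball z \<epsilon>. \<forall>\<gamma>\<in>{a..b}. lo \<le> \<gamma> \<longrightarrow> \<gamma> \<le> hi \<longrightarrow>
      (\<forall>h D. H (u, v, \<gamma>) = ereal h \<longrightarrow> \<zeta> < h \<longrightarrow> h < \<zeta> + \<nu> \<longrightarrow>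
    D \<in> limiting_subdiff H (u, v, \<gamma>) \<longrightarrow> c * (h - \<zeta>) powr \<theta> \<le> norm D))" for \<nu> c \<epsilon> a b
  have mono: "Q \<nu>' c' \<epsilon>' a b" if "Q \<nu> c \<epsilon> a b" "\<nu>' \<le> \<nu>" "c' \<le> c" "\<epsilon>' \<le> \<epsilon>" for \<nu> c \<epsilon> a b \<nu>' c' \<epsilon>'
    unfolding Q_def
  proof (intro ballI impI allI)
    fix u v \<gamma> h D
    assume *: "u \<in> ball z \<epsilon>'" "v \<in> ball z \<epsilon>'" "\<gamma> \<in> {a..b}" "lo \<le> \<gamma>" "\<gamma> \<le> hi" "H (u, v, \<gamma>) = ereal h"
      "\<zeta> < h" "h < \<zeta> + \<nu>'" "D \<in> limiting_subdiff H (u, v, \<gamma>)"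
    have "c' * (h - \<zeta>) powr \<theta> \<le> c * (h - \<zeta>) powr \<theta>"
      using that(3) by (intro mult_right_mono) auto
    also have "\<dots> \<le> norm D"
    proof -
      have "u \<in> ball z \<epsilon>" "v \<in> ball z \<epsilon>" "h < \<zeta> + \<nu>" using * that by auto
      with that(1)[unfolded Q_def] * show ?thesis by blast
    qed
    finally show "c' * (h - \<zeta>) powr \<theta> \<le> norm D" .
  qed
  \<comment> \<open>Compactness of the parameter interval by Bolzano bisection: minima of the
    constants glue two adjacent intervals, and the KL inequality at one \<gamma>0 covers all short
    intervals around it.\<close>
  have "\<exists>\<nu>>0. \<exists>c>0. \<exists>\<epsilon>>0. Q \<nu> c \<epsilon> lo hi"
    using \<open>lo \<le> hi\<close>
  proof (induction rule: Bolzano)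
    case (trans a b d)
    then obtain \<nu>1 c1 \<epsilon>1 \<nu>2 c2 \<epsilon>2 where 1: "0 < \<nu>1" "0 < c1" "0 < \<epsilon>1" "Q \<nu>1 c1 \<epsilon>1 a b"
      and 2: "0 < \<nu>2" "0 < c2" "0 < \<epsilon>2" "Q \<nu>2 c2 \<epsilon>2 b d"
      by blast
    have "Q (min \<nu>1 \<nu>2) (min c1 c2) (min \<epsilon>1 \<epsilon>2) a b" "Q (min \<nu>1 \<nu>2) (min c1 c2) (min \<epsilon>1 \<epsilon>2) b d"
      by (rule mono[OF 1(4)]; simp) (rule mono[OF 2(4)]; simp)
    moreover have "{a..d} = {a..b} \<union> {b..d}" using trans by auto
    ultimately have "Q (min \<nu>1 \<nu>2) (min c1 c2) (min \<epsilon>1 \<epsilon>2) a d"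
      unfolding Q_def by blast
    then show ?case using 1 2 by (meson min_less_iff_conj)
  next
    case (local \<gamma>0)
    obtain \<nu> c \<epsilon> where *: "0 < \<nu>" "0 < c" "0 < \<epsilon>"
      "\<And>w h D. w \<in> ball (z, z, \<gamma>0) \<epsilon> \<Longrightarrow> H w = ereal h \<Longrightarrow> \<zeta> < h \<Longrightarrow> h < \<zeta> + \<nu> \<Longrightarrow>
        D \<in> limiting_subdiff H w \<Longrightarrow> c * (h - \<zeta>) powr \<theta> \<le> norm D"
      using KL_at_with_exponent_inequality[OF KL[OF local] z \<theta>] by blast
    \<comment> \<open>One third for each of the three coordinates, whose distances add up to a bound
      of the product distance.\<close>
    have "Q \<nu> c (\<epsilon> / 3) a b" if "a \<le> \<gamma>0" "\<gamma>0 \<le> b" "b - a < \<epsilon> / 3" for a b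
    proof -
      have "(u, v, \<gamma>) \<in> ball (z, z, \<gamma>0) \<epsilon>"
        if "u \<in> ball z (\<epsilon> / 3)" "v \<in> ball z (\<epsilon> / 3)" "\<gamma> \<in> {a..b}" for u v \<gamma>
      proof -
        have "dist \<gamma>0 \<gamma> < \<epsilon> / 3"
          using that(3) \<open>a \<le> \<gamma>0\<close> \<open>\<gamma>0 \<le> b\<close> \<open>b - a < \<epsilon> / 3\<close>
          unfolding dist_real_def atLeastAtMost_iff by linarith
        moreover have "dist (z, z, \<gamma>0) (u, v, \<gamma>) \<le> dist z u + (dist z v + dist \<gamma>0 \<gamma>)"
          unfolding dist_norm using norm_Pair_le[of "z - u" "(z - v, \<gamma>0 - \<gamma>)"]
            norm_Pair_le[of "z - v" "\<gamma>0 - \<gamma>"] by simp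
        ultimately show ?thesis using that by simp
      qed
      then show ?thesis unfolding Q_def using *(4) by blast
    qed
    then have "\<exists>\<nu>>0. \<exists>c>0. \<exists>\<epsilon>>0. Q \<nu> c \<epsilon> a b" if "a \<le> \<gamma>0" "\<gamma>0 \<le> b" "b - a < \<epsilon> / 3" for a b
      using that *(1-3) by (intro exI[of _ \<nu>] conjI exI[of _ c] exI[of _ "\<epsilon> / 3"]) auto
    moreover have "0 < \<epsilon> / 3" using *(3) by simp
    ultimately show ?case by blast
  qed
  then show ?thesis unfolding Q_def by fastforce
qed

section \<open>One extrapolated proximal step\<close>

lemma closed_fun_continuous_add:
  fixes h :: "'a::t2_space \<Rightarrow> ereal"
  assumes h: "closed_fun h" and q: "\<And>z. isCont q z"
  shows "closed_fun (\<lambda>z. ereal (q z) + h z)"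
  unfolding closed_fun_def le_Liminf_iff
proof (intro allI impI)
  fix z b assume "b < ereal (q z) + h z"
  then obtain b' where b': "b < ereal b'" "ereal b' < ereal (q z) + h z"
    using ereal_dense2 by blast
  then have "ereal (b' - q z) < h z" by (cases "h z") auto
  then obtain e where e: "ereal (b' - q z) < ereal e" "ereal e < h z"
    using ereal_dense2 by blast
  have "\<forall>\<^sub>F w in at z. ereal e < h w"
    using h e(2) unfolding closed_fun_def le_Liminf_iff by blast
  moreover have "\<forall>\<^sub>F w in at z. b' - e < q w"
    using e(1) q[of z] unfolding isCont_def by (intro order_tendstoD(1)) auto
  ultimately show "\<forall>\<^sub>F w in at z. b < ereal (q w) + h w"
  proof eventually_elim
    case (elim w)
    then have "ereal b' < ereal (q w) + h w" by (cases "h w") auto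
    then show ?case using b'(1) by (rule less_trans[rotated])
  qed
qed

text \<open>The radius does not depend on \<gamma>: a large \<gamma> makes the quadratic term beat
  the quadratic minorant of \<open>P1\<close> with t^2 to spare, while on the right \<gamma> enters
  only through the product bounded by \<open>E\<close>. What remains is t^2 \<le> G * t + K,
  impossible beyond the radius.\<close>

lemma subproblem_sublevel_bound:
  assumes lower: "\<And>z. ereal (C - \<mu> / 2 * (norm z)\<^sup>2) \<le> P1 z" and \<mu>: "0 < \<mu>" "2 * \<mu> + 2 \<le> \<gamma>"
    and u: "P1 u \<le> ereal c" "\<gamma> * (norm (u - y))\<^sup>2 \<le> E" "norm (u - y) \<le> e"
    and g: "norm (grad f y - \<xi>) \<le> G" and y: "norm y \<le> \<rho>"
    and w: "subproblem f P1 \<xi> y \<gamma> w \<le> subproblem f P1 \<xi> y \<gamma> u"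
  shows "norm (w - y) \<le> G + \<bar>G * e + E / 2 + c - C + \<mu> * \<rho>\<^sup>2\<bar> + 1"
proof (rule ccontr)
  let ?g = "grad f y - \<xi>" and ?K = "G * e + E / 2 + c - C + \<mu> * \<rho>\<^sup>2"
  define t where "t = norm (w - y)"
  assume "\<not> norm (w - y) \<le> G + \<bar>?K\<bar> + 1"
  then have t: "G + \<bar>?K\<bar> + 1 < t" by (simp add: t_def)
  have G: "0 \<le> G" using g norm_ge_zero order_trans by blast
  have "ereal (?g \<bullet> (w - y) + \<gamma> / 2 * t\<^sup>2 + (C - \<mu> / 2 * (norm w)\<^sup>2))
      \<le> subproblem f P1 \<xi> y \<gamma> w"
    using lower[of w] unfolding subproblem_def t_def plus_ereal.simps(1)[symmetric]
    by (intro add_left_mono)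
  also have "\<dots> \<le> ereal (?g \<bullet> (u - y) + \<gamma> / 2 * (norm (u - y))\<^sup>2) + ereal c"
    using w u(1) unfolding subproblem_def by (meson add_left_mono order_trans)
  finally have 1: "?g \<bullet> (w - y) + \<gamma> / 2 * t\<^sup>2 + (C - \<mu> / 2 * (norm w)\<^sup>2)
      \<le> ?g \<bullet> (u - y) + \<gamma> / 2 * (norm (u - y))\<^sup>2 + c" by simp
  have 2: "?g \<bullet> (u - y) \<le> G * e"
    using norm_cauchy_schwarz[of ?g "u - y"] mult_mono[OF g u(3) G norm_ge_zero] by linarith
  have 3: "- (G * t) \<le> ?g \<bullet> (w - y)"
    using Cauchy_Schwarz_ineq2[of ?g "w - y"] mult_right_mono[OF g, of t] unfolding t_def
    by (simp add: abs_le_iff)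
  have 4: "\<mu> / 2 * (norm w)\<^sup>2 \<le> \<mu> * t\<^sup>2 + \<mu> * \<rho>\<^sup>2"
  proof -
    have "norm w \<le> t + \<rho>" using norm_triangle_ineq[of "w - y" y] y by (simp add: t_def)
    then have "(norm w)\<^sup>2 \<le> (t + \<rho>)\<^sup>2" by (intro power_mono) auto
    also have "\<dots> \<le> 2 * t\<^sup>2 + 2 * \<rho>\<^sup>2"
      using zero_le_power2[of "t - \<rho>"] by (simp add: power2_eq_square algebra_simps)
    finally have "\<mu> / 2 * (norm w)\<^sup>2 \<le> \<mu> / 2 * (2 * t\<^sup>2 + 2 * \<rho>\<^sup>2)"
      using \<mu>(1) by (intro mult_left_mono) auto
    then show ?thesis by (simp add: algebra_simps)
  qed
  have "(\<mu> + 1) * t\<^sup>2 \<le> \<gamma> / 2 * t\<^sup>2" using \<mu>(2) by (intro mult_right_mono) auto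
  then have "t\<^sup>2 \<le> G * t + ?K" using 1 2 3 4 u(2) by (simp add: algebra_simps)
  moreover have "(G + \<bar>?K\<bar> + 1) * t \<le> t\<^sup>2"
    using t G by (simp add: power2_eq_square mult_right_mono)
  moreover have "\<bar>?K\<bar> * 1 \<le> \<bar>?K\<bar> * t" using t G by (intro mult_left_mono) auto
  moreover have "0 < t" using t G by linarith
  ultimately show False by (simp add: ring_distribs)
qed

text \<open>Optimality of \<open>w\<close> for the model, the subgradient inequality of the
  subtracted function and the increment bound are added up. The factor 12 makes the Lipschitz error
  consume only 1/8 of the squared step, out of the 1/2 that the proximal term provides.\<close>

lemma extrapolated_step_descent:
  fixes u w y g \<xi> :: "'a::real_inner"
  assumes inc: "fw - fu - g \<bullet> (w - u) \<le> L * (norm (w - u) + norm (u - y)) * norm (w - u)"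
    and sub: "qu + \<xi> \<bullet> (w - u) \<le> qw"
    and opt: "(g - \<xi>) \<bullet> (w - y) + \<gamma> / 2 * (norm (w - y))\<^sup>2 + pw
      \<le> (g - \<xi>) \<bullet> (u - y) + \<gamma> / 2 * (norm (u - y))\<^sup>2 + pu"
    and L: "0 \<le> L" "12 * L \<le> \<gamma>"
  shows "fw + pw - qw + \<gamma> / 8 * (norm (w - u))\<^sup>2 \<le> fu + pu - qu + 2 * \<gamma> * (norm (u - y))\<^sup>2"
proof -
  define a b where "a = norm (w - u)" and "b = norm (u - y)"
  have \<gamma>: "0 \<le> \<gamma>" using L by linarith
  have "(norm (w - y))\<^sup>2 = a\<^sup>2 + 2 * ((w - u) \<bullet> (u - y)) + b\<^sup>2"
    unfolding a_def b_def power2_norm_eq_inner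
    by (simp add: inner_diff_left inner_diff_right inner_commute algebra_simps)
  moreover have "- (a * b) \<le> (w - u) \<bullet> (u - y)"
    using Cauchy_Schwarz_ineq2[of "w - u" "u - y"] by (simp add: a_def b_def abs_le_iff)
  ultimately have "a\<^sup>2 - 2 * (a * b) + b\<^sup>2 \<le> (norm (w - y))\<^sup>2" by linarith
  then have 1: "\<gamma> / 2 * (a\<^sup>2 - 2 * (a * b) + b\<^sup>2) \<le> \<gamma> / 2 * (norm (w - y))\<^sup>2"
    using \<gamma> by (intro mult_left_mono) auto
  have ab: "2 * (a * b) \<le> a\<^sup>2 + b\<^sup>2" "a * b \<le> a\<^sup>2 / 4 + b\<^sup>2"
    using zero_le_power2[of "a - b"] zero_le_power2[of "a / 2 - b"]
    by (simp_all add: power2_eq_square algebra_simps)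
  have "L * (a + b) * a = L * (a\<^sup>2 + a * b)" by (simp add: power2_eq_square algebra_simps)
  also have "\<dots> \<le> L * (3 / 2 * a\<^sup>2 + b\<^sup>2 / 2)"
    using ab L by (intro mult_left_mono) auto
  also have "\<dots> \<le> \<gamma> / 12 * (3 / 2 * a\<^sup>2 + b\<^sup>2 / 2)"
    using L by (intro mult_right_mono) auto
  finally have 2: "L * (a + b) * a \<le> \<gamma> / 8 * a\<^sup>2 + \<gamma> / 24 * b\<^sup>2" by (simp add: algebra_simps)
  have 3: "\<gamma> * (a * b) \<le> \<gamma> * (a\<^sup>2 / 4 + b\<^sup>2)"
    using ab \<gamma> by (intro mult_left_mono) auto
  have "g \<bullet> (w - y) - g \<bullet> (u - y) = g \<bullet> (w - u)" "\<xi> \<bullet> (w - y) - \<xi> \<bullet> (u - y) = \<xi> \<bullet> (w - u)"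
    by (simp_all flip: inner_diff_right)
  then have "fw + pw - qw - (fu + pu - qu) \<le> L * (a + b) * a + \<gamma> / 2 * b\<^sup>2 - \<gamma> / 2 * (norm (w - y))\<^sup>2"
    using inc sub opt unfolding a_def[symmetric] b_def[symmetric]
    by (simp add: inner_diff_left)
  also have "\<dots> \<le> \<gamma> / 8 * a\<^sup>2 + \<gamma> / 24 * b\<^sup>2 + \<gamma> / 2 * b\<^sup>2 - \<gamma> / 2 * (a\<^sup>2 - 2 * (a * b) + b\<^sup>2)"
    using 1 2 by linarith
  also have "\<dots> = \<gamma> / 24 * b\<^sup>2 - 3 / 8 * (\<gamma> * a\<^sup>2) + \<gamma> * (a * b)"
    by (simp add: algebra_simps)
  \<comment> \<open>The cross term is split by a * b \<le> a^2 / 4 + b^2: it takes 2/8 of the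
    available 3/8, and 1/8 survives; the coefficient 25/24 of b^2 is rounded up to 2.\<close>
  also have "\<dots> \<le> 2 * \<gamma> * b\<^sup>2 - \<gamma> / 8 * a\<^sup>2"
  proof -
    have "0 \<le> \<gamma> * b\<^sup>2" using \<gamma> by simp
    then show ?thesis using 3 by (simp add: ring_distribs)
  qed
  finally show ?thesis by (simp add: a_def b_def)
qed

text \<open>\<open>r0\<close>, \<open>r1\<close>, \<open>r2\<close> stand for the gaps to the limit
  at three consecutive indices, \<open>h\<close> for the gap of the accepted potential value. The
  threshold is half of the oldest gap: below it averaging alone removes the share p/2, and a gap at
  most 1 dominates its own power; above it the bound on \<open>h powr s\<close> applies to at least
  half of the oldest gap.\<close>

lemma reference_decrease:
  fixes r0 r1 r2 h :: real
  assumes r: "0 \<le> r2" "r2 \<le> r1" "r1 \<le> r0" "r0 \<le> 1" and p: "0 < p" "p \<le> 1" and "1 \<le> s" "0 < C"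
    and avg: "r2 \<le> (1 - p) * r1 + p * max h 0"
    and h: "0 < h \<Longrightarrow> h powr s \<le> C * (r0 - r2)"
  shows "min (p / 2) (1 / (C * 2 powr s)) * r0 powr s \<le> r0 - r2"
proof (cases "max h 0 \<le> r0 / 2")
  case True
  have "min (p / 2) (1 / (C * 2 powr s)) * r0 powr s \<le> p / 2 * r0"
  proof (rule mult_mono)
    show "r0 powr s \<le> r0"
      using powr_mono'[of 1 s r0] r assms by simp
  qed (use p in auto)
  also have "\<dots> \<le> r0 - ((1 - p) * r0 + p * (r0 / 2))" by (simp add: algebra_simps)
  also have "\<dots> \<le> r0 - ((1 - p) * r1 + p * max h 0)"
    using r p True by (intro diff_left_mono add_mono mult_left_mono) auto
  also have "\<dots> \<le> r0 - r2" using avg by simp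
  finally show ?thesis .
next
  case False
  then have h0: "0 < h" "r0 / 2 \<le> h" using r by (auto simp: max_def split: if_splits)
  have "min (p / 2) (1 / (C * 2 powr s)) * r0 powr s \<le> 1 / (C * 2 powr s) * r0 powr s"
    by (intro mult_right_mono) auto
  also have "\<dots> = (r0 / 2) powr s / C"
    using r by (simp add: powr_divide)
  also have "\<dots> \<le> h powr s / C"
    using h0 r assms by (intro divide_right_mono powr_mono2) auto
  also have "\<dots> \<le> r0 - r2" using h[OF h0(1)] assms by (simp add: divide_le_eq mult.commute)
  finally show ?thesis .
qed

section \<open>Runs of the algorithm\<close>

text \<open>Here \<open>p k\<close> is the weight called \<open>p\<close> with index \<open>k + 1\<close> in the algorithm; below, \<open>d k\<close>, \<open>\<gamma>b k\<close> and \<open>Hr k\<close>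
  all refer to the step from \<open>x k\<close> to \<open>x (Suc k)\<close>.\<close>

locale nexPGA_run =
  fixes f P2 :: "'a::euclidean_space \<Rightarrow> real" and P1 :: "'a \<Rightarrow> ereal"
    and \<gamma>min \<gamma>max \<beta>max pmin \<delta> \<tau> \<eta> :: real
    and x \<xi> :: "nat \<Rightarrow> 'a" and R \<beta>0 \<gamma>0 p :: "nat \<Rightarrow> real" and J :: "nat \<Rightarrow> nat"
  assumes f_C1: "continuously_differentiable_on UNIV f"
    and f_grad_lipschitz: "locally_lipschitz_on UNIV (grad f)"
    and P1_proper: "proper_fun P1" and P1_closed: "closed_fun P1" and P1_prox: "prox_bounded P1"
    and P2_convex: "convex_on UNIV P2"
    and bounded_below: "\<exists>m::real. \<forall>u\<in>edom P1. ereal m \<le> objective f P1 P2 u"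
    and params: "0 < \<gamma>min" "\<gamma>min \<le> \<gamma>max" "0 \<le> \<beta>max" "0 < pmin" "pmin < 1"
      "0 \<le> \<delta>" "\<delta> < 1" "1 < \<tau>" "0 < \<eta>" "\<eta> < 1 / sqrt \<tau>"
    and x0: "x 0 \<in> edom P1" and R0: "ereal (R 0) = objective f P1 P2 (x 0)"
    and \<xi>: "\<And>k. \<xi> k \<in> limiting_subdiff (\<lambda>u. ereal (P2 u)) (x k)"
    and \<beta>0: "\<And>k. 0 \<le> \<beta>0 k" "\<And>k. \<beta>0 k \<le> \<delta> * \<beta>max"
    and \<gamma>0: "\<And>k. \<gamma>min \<le> \<gamma>0 k" "\<And>k. \<gamma>0 k \<le> \<gamma>max"
    and failed: "\<And>k i. i < J k \<Longrightarrow>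
      (\<nexists>w. is_arg_min (subproblem f P1 (\<xi> k) (x k + (\<eta> ^ i * \<beta>0 k) *\<^sub>R (x k - x (k - 1)))
         (\<tau> ^ i * \<gamma>0 k)) (\<lambda>_. True) w) \<or>
      (\<exists>w. is_arg_min (subproblem f P1 (\<xi> k) (x k + (\<eta> ^ i * \<beta>0 k) *\<^sub>R (x k - x (k - 1)))
         (\<tau> ^ i * \<gamma>0 k)) (\<lambda>_. True) w \<and>
         \<not> line_search \<delta> (objective f P1 P2) (R k) (\<tau> ^ i * \<gamma>0 k) (x k) w)"
    and accepted: "\<And>k. is_arg_min (subproblem f P1 (\<xi> k)
        (x k + (\<eta> ^ J k * \<beta>0 k) *\<^sub>R (x k - x (k - 1))) (\<tau> ^ J k * \<gamma>0 k)) (\<lambda>_. True) (x (Suc k))"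
      "\<And>k. line_search \<delta> (objective f P1 P2) (R k) (\<tau> ^ J k * \<gamma>0 k) (x k) (x (Suc k))"
    and p: "\<And>k. pmin \<le> p k" "\<And>k. p k \<le> 1"
    and R_Suc: "\<And>k. ereal (R (Suc k)) = ereal ((1 - p k) * R k)
        + ereal (p k) * potential \<delta> (objective f P1 P2) (x (Suc k), x k, \<tau> ^ J k * \<gamma>0 k)"
begin

abbreviation "F \<equiv> objective f P1 P2"

definition "yb k = x k + (\<eta> ^ J k * \<beta>0 k) *\<^sub>R (x k - x (k - 1))"
definition "\<gamma>b k = \<tau> ^ J k * \<gamma>0 k"
definition "Fr k = real_of_ereal (F (x k))"
definition "d k = norm (x (Suc k) - x k)"
definition "Hr k = Fr (Suc k) + \<delta> * \<gamma>b k / 8 * (d k)\<^sup>2"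
text \<open>Guaranteed decrease of the reference value per squared step: (1 - \<delta>) *
  \<gamma>min / 8 from the line search, diluted by the smallest averaging weight.\<close>

definition "\<kappa> = pmin * (1 - \<delta>) * \<gamma>min / 8"
definition "\<zeta> = lim R"

section \<open>Finite values, monotone reference values and vanishing steps\<close>

lemma P1_not_MInf: "P1 u \<noteq> -\<infinity>"
  using P1_proper by (auto simp: proper_fun_def)

lemma f_differentiable: "f differentiable (at u)"
  using f_C1 by (simp add: continuously_differentiable_on_def)

lemma isCont_f: "isCont f u"
  using f_differentiable differentiable_imp_continuous_within by blast

lemma isCont_P2: "isCont P2 u"
  using convex_on_continuous[OF open_UNIV P2_convex] by (simp add: continuous_on_eq_continuous_at)

lemma isCont_grad_f: "isCont (grad f) u"
  using f_C1 by (simp add: continuously_differentiable_on_def continuous_on_eq_continuous_at)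

lemma \<xi>_subgradient: "P2 (x k) + \<xi> k \<bullet> (z - x k) \<le> P2 z"
  using \<xi> limiting_subdiff_convex_iff[OF P2_convex] by blast

lemma x_in_edom: "x k \<in> edom P1"
proof (cases k)
  case (Suc j)
  have "P1 (x (Suc j)) \<noteq> \<infinity>"
  proof
    assume "P1 (x (Suc j)) = \<infinity>"
    then show False
      using accepted(2)[of j] by (simp add: line_search_def potential_def objective_def)
  qed
  then show ?thesis using Suc by (simp add: edom_def)
qed (use x0 in simp)

lemma F_x: "F (x k) = ereal (Fr k)"
  and P1_x: "P1 (x k) = ereal (Fr k - f (x k) + P2 (x k))"
proof -
  obtain c where "P1 (x k) = ereal c"
    using x_in_edom[of k] P1_not_MInf[of "x k"] by (cases "P1 (x k)") (auto simp: edom_def)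
  then show "F (x k) = ereal (Fr k)" "P1 (x k) = ereal (Fr k - f (x k) + P2 (x k))"
    by (auto simp: Fr_def objective_def)
qed

lemma H_x: "potential \<delta> F (x (Suc k), x k, \<gamma>b k) = ereal (Hr k)"
  by (simp add: potential_def F_x Hr_def d_def)

lemma \<tau>_power_ge_1: "1 \<le> \<tau> ^ i"
  using params by simp

lemma \<gamma>_trial_ge: "\<gamma>min \<le> \<tau> ^ i * \<gamma>0 k"
proof -
  have "1 * \<gamma>min \<le> \<tau> ^ i * \<gamma>0 k"
    using \<gamma>0(1)[of k] params \<tau>_power_ge_1 by (intro mult_mono) auto
  then show ?thesis by simp
qed

lemma \<gamma>b_ge: "\<gamma>min \<le> \<gamma>b k" and \<gamma>b_pos: "0 < \<gamma>b k"
  using \<gamma>_trial_ge[of "J k" k] params by (auto simp: \<gamma>b_def)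

lemma d_nonneg: "0 \<le> d k"
  by (simp add: d_def)

lemma Hr_le: "Hr k \<le> R k - (1 - \<delta>) * \<gamma>b k / 8 * (d k)\<^sup>2"
  using accepted(2)[of k] by (simp add: line_search_def H_x d_def flip: \<gamma>b_def)

lemma R_Suc_eq: "R (Suc k) = (1 - p k) * R k + p k * Hr k"
  using R_Suc[of k] by (simp add: H_x flip: \<gamma>b_def)

lemma Hr_le_R: "Hr k \<le> R k"
proof -
  have "0 \<le> (1 - \<delta>) * \<gamma>b k / 8 * (d k)\<^sup>2" using params \<gamma>b_pos[of k] by simp
  then show ?thesis using Hr_le[of k] by linarith
qed

lemma Fr_le_Hr: "Fr (Suc k) \<le> Hr k"
  using params \<gamma>b_pos[of k] by (simp add: Hr_def)

lemma Hr_le_R_Suc: "Hr k \<le> R (Suc k)"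
proof -
  have "0 \<le> (1 - p k) * (R k - Hr k)" using Hr_le_R[of k] p by simp
  then show ?thesis by (simp add: R_Suc_eq algebra_simps)
qed

lemma p_pos: "0 < p k"
  using p(1)[of k] params by linarith

lemma R_decrease: "p k * (R k - Hr k) = R k - R (Suc k)"
  by (simp add: R_Suc_eq algebra_simps)

lemma R_Suc_le: "R (Suc k) \<le> R k"
  using R_decrease[of k] Hr_le_R[of k] p_pos[of k]
  by (metis diff_ge_0_iff_ge less_imp_le mult_nonneg_nonneg)

lemma R_antimono: "j \<le> k \<Longrightarrow> R k \<le> R j"
  using R_Suc_le lift_Suc_antimono_le by blast

lemma \<kappa>_pos: "0 < \<kappa>"
  using params by (simp add: \<kappa>_def)

lemma \<kappa>_step: "\<kappa> * (d k)\<^sup>2 \<le> R k - R (Suc k)"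
proof -
  have "\<kappa> * (d k)\<^sup>2 = pmin * ((1 - \<delta>) * \<gamma>min / 8 * (d k)\<^sup>2)" by (simp add: \<kappa>_def)
  also have "\<dots> \<le> p k * ((1 - \<delta>) * \<gamma>b k / 8 * (d k)\<^sup>2)"
    using params p(1)[of k] p_pos[of k] \<gamma>b_ge[of k]
    by (intro mult_mono divide_right_mono mult_left_mono mult_nonneg_nonneg) auto
  also have "\<dots> \<le> p k * (R k - Hr k)"
    using Hr_le[of k] p_pos[of k] by (intro mult_left_mono) auto
  finally show ?thesis by (simp add: R_decrease)
qed

lemma Fr_le_R: "Fr k \<le> R k"
proof (cases k)
  case 0
  then show ?thesis using R0 F_x[of 0] by simp
next
  case (Suc j)
  then show ?thesis using Fr_le_Hr[of j] Hr_le_R_Suc[of j] by simp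
qed

lemma R_bounded_below: "\<exists>m. \<forall>k. m \<le> R k"
proof -
  obtain m where "\<And>u. u \<in> edom P1 \<Longrightarrow> ereal m \<le> F u" using bounded_below by blast
  then have "m \<le> Fr k" for k using x_in_edom[of k] F_x[of k] by (metis ereal_less_eq(3))
  then show ?thesis using Fr_le_R order_trans by blast
qed

lemma R_convergent: "convergent R"
proof -
  obtain m where "\<And>k. m \<le> R k" using R_bounded_below by blast
  then show ?thesis
    using decseq_convergent[of R m] R_antimono unfolding decseq_def convergent_def by blast
qed

lemma R_tendsto: "R \<longlonglongrightarrow> \<zeta>"
  using R_convergent by (simp add: \<zeta>_def convergent_LIMSEQ_iff)

lemma \<zeta>_le_R: "\<zeta> \<le> R k"
  using decseq_ge[OF _ R_tendsto] R_antimono by (auto simp: decseq_def)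

lemma d_tendsto_0: "d \<longlonglongrightarrow> 0"
proof -
  have "(\<lambda>k. (R k - R (Suc k)) / \<kappa>) \<longlonglongrightarrow> (\<zeta> - \<zeta>) / \<kappa>"
    using \<kappa>_pos by (intro tendsto_intros R_tendsto LIMSEQ_Suc[OF R_tendsto]) auto
  then have lim: "(\<lambda>k. (R k - R (Suc k)) / \<kappa>) \<longlonglongrightarrow> 0" by simp
  have "(\<lambda>k. (d k)\<^sup>2) \<longlonglongrightarrow> 0"
    by (rule tendsto_sandwich[OF _ _ tendsto_const lim])
       (use \<kappa>_step \<kappa>_pos in \<open>auto simp: field_simps\<close>)
  then show ?thesis by simp
qed

text \<open>The gap divided by pmin bounds R k - Hr k, and through the line search it bounds the
  product of \<gamma>b and the squared step as a whole, whatever the size of \<gamma>b. Adding the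
  shares 1 and \<delta> / (1 - \<delta>) gives the factor 1 / (1 - \<delta>).\<close>

lemma Fr_rate: "\<bar>Fr (Suc k) - \<zeta>\<bar> \<le> (R k - \<zeta>) / (pmin * (1 - \<delta>))"
proof -
  let ?r = "R k - \<zeta>"
  have r: "0 \<le> ?r" using \<zeta>_le_R by simp
  have "pmin * (R k - Hr k) \<le> p k * (R k - Hr k)"
    using p(1) Hr_le_R[of k] by (intro mult_right_mono) auto
  also have "\<dots> \<le> ?r" using R_decrease[of k] \<zeta>_le_R[of "Suc k"] by simp
  finally have gap: "R k - Hr k \<le> ?r / pmin" using params by (simp add: pos_le_divide_eq mult.commute)
  have "(1 - \<delta>) * (\<gamma>b k / 8 * (d k)\<^sup>2) = (1 - \<delta>) * \<gamma>b k / 8 * (d k)\<^sup>2" by simp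
  also have "\<dots> \<le> ?r / pmin" using Hr_le[of k] gap by linarith
  finally have "(1 - \<delta>) * (\<gamma>b k / 8 * (d k)\<^sup>2) \<le> ?r / pmin" .
  then have "\<gamma>b k / 8 * (d k)\<^sup>2 \<le> ?r / pmin / (1 - \<delta>)"
    using params by (simp add: pos_le_divide_eq mult.commute)
  then have "\<delta> * (\<gamma>b k / 8 * (d k)\<^sup>2) \<le> \<delta> * (?r / pmin / (1 - \<delta>))"
    using params by (intro mult_left_mono) auto
  then have "Fr (Suc k) \<ge> R k - ?r / pmin - \<delta> * (?r / pmin / (1 - \<delta>))"
    using gap by (simp add: Hr_def)
  moreover have "?r / pmin + \<delta> * (?r / pmin / (1 - \<delta>)) = ?r / (pmin * (1 - \<delta>))"
    using params by (simp add: divide_simps) (simp add: algebra_simps)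
  ultimately have "\<zeta> - ?r / (pmin * (1 - \<delta>)) \<le> Fr (Suc k)"
    using r by linarith
  moreover have "Fr (Suc k) - \<zeta> \<le> ?r / (pmin * (1 - \<delta>))"
  proof -
    have "pmin * (1 - \<delta>) \<le> 1" using params by (intro mult_le_one) auto
    then have "?r * (pmin * (1 - \<delta>)) \<le> ?r" using r by (intro mult_left_le) auto
    then have "?r \<le> ?r / (pmin * (1 - \<delta>))" using params by (simp add: pos_le_divide_eq)
    then show ?thesis using Fr_le_Hr[of k] Hr_le_R[of k] by linarith
  qed
  ultimately show ?thesis by linarith
qed

lemma Fr_tendsto: "Fr \<longlonglongrightarrow> \<zeta>"
proof (rule LIMSEQ_imp_Suc)
  have "(\<lambda>k. (R k - \<zeta>) / (pmin * (1 - \<delta>))) \<longlonglongrightarrow> (\<zeta> - \<zeta>) / (pmin * (1 - \<delta>))"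
    using params by (intro tendsto_intros R_tendsto) auto
  then have "(\<lambda>k. (R k - \<zeta>) / (pmin * (1 - \<delta>))) \<longlonglongrightarrow> 0" by simp
  then have "(\<lambda>k. Fr (Suc k) - \<zeta>) \<longlonglongrightarrow> 0"
    by (rule Lim_null_comparison[rotated]) (use Fr_rate in auto)
  then show "(\<lambda>k. Fr (Suc k)) \<longlonglongrightarrow> \<zeta>" by (simp add: LIM_zero_iff)
qed


section \<open>Local boundedness of the accepted proximal parameters\<close>

definition "yt k i = x k + (\<eta> ^ i * \<beta>0 k) *\<^sub>R (x k - x (k - 1))"
definition "\<gamma>t k i = \<tau> ^ i * \<gamma>0 k"

lemma \<beta>_trial: "0 \<le> \<eta> ^ i * \<beta>0 k" "\<eta> ^ i * \<beta>0 k \<le> \<beta>max"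
proof -
  show "0 \<le> \<eta> ^ i * \<beta>0 k" using params \<beta>0(1)[of k] by simp
  have "1 < sqrt \<tau>" using params by simp
  then have "\<eta> \<le> 1" using params(10) by (smt (verit) divide_le_eq_1)
  then have "\<eta> ^ i * \<beta>0 k \<le> 1 * (\<delta> * \<beta>max)"
    using params \<beta>0[of k] by (intro mult_mono power_le_one) auto
  also have "\<dots> \<le> \<beta>max" using params by (simp add: mult_left_le_one_le)
  finally show "\<eta> ^ i * \<beta>0 k \<le> \<beta>max" .
qed

lemma \<tau>\<eta>_less_1: "0 < \<tau> * \<eta>\<^sup>2" "\<tau> * \<eta>\<^sup>2 < 1"
proof -
  show "0 < \<tau> * \<eta>\<^sup>2" using params by simp
  have "\<eta>\<^sup>2 < (1 / sqrt \<tau>)\<^sup>2" using params by (intro power_strict_mono) auto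
  then have "\<eta>\<^sup>2 < 1 / \<tau>" using params by (simp add: power_divide)
  then show "\<tau> * \<eta>\<^sup>2 < 1" using params by (simp add: pos_less_divide_eq mult.commute)
qed

text \<open>Per trial \<gamma> is multiplied by \<tau> and the extrapolation by \<eta>, so the
  product with the squared distance scales by \<tau> * \<eta>^2 < 1. One factor \<delta> is kept
  from \<beta>0 \<le> \<delta> * \<beta>max, to match the \<delta> in
  \<open>previous_step_le_R\<close>.\<close>

lemma trial_extrapolation:
  "\<gamma>t k i * (norm (x k - yt k i))\<^sup>2 \<le> (\<tau> * \<eta>\<^sup>2) ^ i * (\<gamma>max * \<delta> * \<beta>max\<^sup>2) * (norm (x k - x (k - 1)))\<^sup>2"
proof -
  have "\<gamma>t k i * (norm (x k - yt k i))\<^sup>2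
      = (\<tau> * \<eta>\<^sup>2) ^ i * (\<gamma>0 k * (\<beta>0 k)\<^sup>2) * (norm (x k - x (k - 1)))\<^sup>2"
    by (simp add: \<gamma>t_def yt_def power_mult_distrib power_mult[symmetric] mult.commute[of 2] mult_ac)
  also have "\<dots> \<le> (\<tau> * \<eta>\<^sup>2) ^ i * (\<gamma>max * \<delta> * \<beta>max\<^sup>2) * (norm (x k - x (k - 1)))\<^sup>2"
  proof (intro mult_right_mono mult_left_mono)
    have "(\<beta>0 k)\<^sup>2 \<le> (\<delta> * \<beta>max)\<^sup>2" using \<beta>0[of k] by (intro power_mono) auto
    also have "\<dots> \<le> \<delta> * \<beta>max\<^sup>2"
      using params by (simp add: power_mult_distrib power2_eq_square[of \<delta>] mult_left_le_one_le mult.assoc)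
    finally have "\<gamma>0 k * (\<beta>0 k)\<^sup>2 \<le> \<gamma>max * (\<delta> * \<beta>max\<^sup>2)"
      using \<gamma>0[of k] params by (intro mult_mono) auto
    then show "\<gamma>0 k * (\<beta>0 k)\<^sup>2 \<le> \<gamma>max * \<delta> * \<beta>max\<^sup>2" by (simp add: mult.assoc)
  qed (use \<tau>\<eta>_less_1 in auto)
  finally show ?thesis .
qed

lemma trial_point_near:
  assumes k: "x k \<in> cball z 1" "x (k - 1) \<in> cball z 1"
  shows "norm (x k - x (k - 1)) \<le> 2" "norm (x k - yt k i) \<le> 2 * \<beta>max"
    "yt k i \<in> cball z (1 + 2 * \<beta>max)"
proof -
  show step: "norm (x k - x (k - 1)) \<le> 2"
    using k dist_triangle3[of "x k" "x (k - 1)" z] by (simp add: dist_norm)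
  have "norm (x k - yt k i) = (\<eta> ^ i * \<beta>0 k) * norm (x k - x (k - 1))"
    using \<beta>_trial(1)[of i k] by (simp add: yt_def)
  also have "\<dots> \<le> \<beta>max * 2" using step \<beta>_trial[of i k] params by (intro mult_mono) auto
  finally show xy: "norm (x k - yt k i) \<le> 2 * \<beta>max" by simp
  show "yt k i \<in> cball z (1 + 2 * \<beta>max)"
    using k(1) xy dist_triangle[of z "yt k i" "x k"] by (simp add: dist_norm)
qed

text \<open>The reserve that pays for extrapolation: the potential value of the preceding step,
  including its quadratic term, lies below \<open>R k\<close>. At \<open>k = 0\<close> the step is
  zero since \<open>0 - 1 = 0\<close>.\<close>

lemma previous_step_le_R: "Fr k + \<delta> * \<gamma>min / 8 * (norm (x k - x (k - 1)))\<^sup>2 \<le> R k"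
proof (cases k)
  case 0
  then show ?thesis using Fr_le_R[of 0] by simp
next
  case (Suc j)
  have "\<delta> * \<gamma>min / 8 * (d j)\<^sup>2 \<le> \<delta> * \<gamma>b j / 8 * (d j)\<^sup>2"
    using \<gamma>b_ge[of j] params by (intro mult_right_mono divide_right_mono mult_left_mono) auto
  then show ?thesis using Suc Hr_le_R_Suc[of j] by (simp add: Hr_def d_def)
qed

lemma closed_subproblem: "closed_fun (subproblem f P1 \<xi>' y \<gamma>)"
  unfolding subproblem_def
  by (rule closed_fun_continuous_add[OF P1_closed]) (intro continuous_intros)

text \<open>Prox-boundedness makes subproblems with large \<gamma> coercive, and near
  \<open>z\<close> all data of the bound stay bounded, so one radius serves all iterations and
  trials.\<close>

lemma trial_minimizer_near:
  "\<exists>\<Gamma> T. \<forall>k i. x k \<in> cball z 1 \<longrightarrow> x (k - 1) \<in> cball z 1 \<longrightarrow> \<Gamma> \<le> \<gamma>t k i \<longrightarrow>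
    (\<exists>w. is_arg_min (subproblem f P1 (\<xi> k) (yt k i) (\<gamma>t k i)) (\<lambda>_. True) w) \<and>
    (\<forall>w. is_arg_min (subproblem f P1 (\<xi> k) (yt k i) (\<gamma>t k i)) (\<lambda>_. True) w \<longrightarrow>
      norm (w - yt k i) \<le> T)"
proof -
  obtain \<mu> C where \<mu>: "0 < \<mu>" and lower: "\<And>v. ereal (C - \<mu> / 2 * (norm v)\<^sup>2) \<le> P1 v"
    using prox_bounded_lower_bound[OF P1_prox] by blast
  obtain M where M: "\<And>k. x k \<in> cball z 1 \<Longrightarrow> norm (\<xi> k) \<le> M"
    using convex_subgradients_bounded[OF P2_convex, of z 1] \<xi>_subgradient by blast
  have "bounded ((\<lambda>u. P2 u - f u) ` cball z 1)"
    by (intro compact_imp_bounded compact_continuous_image continuous_at_imp_continuous_on)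
       (auto intro!: continuous_intros isCont_f isCont_P2)
  then obtain B where B: "\<And>u. u \<in> cball z 1 \<Longrightarrow> \<bar>P2 u - f u\<bar> \<le> B"
    unfolding bounded_iff by (metis imageI real_norm_def)
  have "bounded (grad f ` cball z (1 + 2 * \<beta>max))"
    by (intro compact_imp_bounded compact_continuous_image continuous_at_imp_continuous_on)
       (auto intro!: isCont_grad_f)
  then obtain G where G: "\<And>u. u \<in> cball z (1 + 2 * \<beta>max) \<Longrightarrow> norm (grad f u) \<le> G"
    unfolding bounded_iff by (metis imageI)
  \<comment> \<open>The 4 is the square of the diameter of the unit ball, which contains both
    \<open>x k\<close> and \<open>x (k - 1)\<close>; powers of \<tau> * \<eta>^2 are at most
    1.\<close>
  define E where "E = 4 * (\<gamma>max * \<delta> * \<beta>max\<^sup>2)"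
  define \<rho> where "\<rho> = norm z + (1 + 2 * \<beta>max)"
  define T where "T = (G + M) + \<bar>(G + M) * (2 * \<beta>max) + E / 2 + (R 0 + B) - C + \<mu> * \<rho>\<^sup>2\<bar> + 1"
  have "(\<exists>w. is_arg_min (subproblem f P1 (\<xi> k) (yt k i) (\<gamma>t k i)) (\<lambda>_. True) w) \<and>
    (\<forall>w. is_arg_min (subproblem f P1 (\<xi> k) (yt k i) (\<gamma>t k i)) (\<lambda>_. True) w \<longrightarrow>
      norm (w - yt k i) \<le> T)"
    if k: "x k \<in> cball z 1" "x (k - 1) \<in> cball z 1" and i: "2 * \<mu> + 2 \<le> \<gamma>t k i" for k i
  proof -
    let ?S = "subproblem f P1 (\<xi> k) (yt k i) (\<gamma>t k i)"
    note step = trial_point_near(1)[OF k] and xy = trial_point_near(2)[OF k, of i]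
      and y = trial_point_near(3)[OF k, of i]
    have E: "\<gamma>t k i * (norm (x k - yt k i))\<^sup>2 \<le> E"
    proof -
      have "(norm (x k - x (k - 1)))\<^sup>2 \<le> 2\<^sup>2" using step by (intro power_mono) auto
      moreover have "(\<tau> * \<eta>\<^sup>2) ^ i \<le> 1" using \<tau>\<eta>_less_1 by (intro power_le_one) auto
      moreover have "0 \<le> \<gamma>max * \<delta> * \<beta>max\<^sup>2" using params by simp
      ultimately have "(\<tau> * \<eta>\<^sup>2) ^ i * (\<gamma>max * \<delta> * \<beta>max\<^sup>2) * (norm (x k - x (k - 1)))\<^sup>2
          \<le> 1 * (\<gamma>max * \<delta> * \<beta>max\<^sup>2) * 2\<^sup>2"
        using \<tau>\<eta>_less_1 params by (intro mult_mono mult_nonneg_nonneg) auto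
      then show ?thesis using trial_extrapolation[of k i] by (simp add: E_def)
    qed
    \<comment> \<open>\<open>P1\<close> is bounded above along the iterates near \<open>z\<close>
      because F (x k) \<le> R k \<le> R 0.\<close>
    have P1x: "P1 (x k) \<le> ereal (R 0 + B)"
      using P1_x[of k] B[OF k(1)] Fr_le_R[of k] R_antimono[of 0 k] by (simp add: abs_le_iff)
    have g: "norm (grad f (yt k i) - \<xi> k) \<le> G + M"
      using G[OF y] M[OF k(1)] norm_triangle_ineq4[of "grad f (yt k i)" "\<xi> k"] by linarith
    have ny: "norm (yt k i) \<le> \<rho>"
      using y norm_triangle_ineq[of z "yt k i - z"] by (simp add: \<rho>_def dist_norm norm_minus_commute)
    have bound: "norm (w - yt k i) \<le> T" if "?S w \<le> ?S (x k)" for w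
      unfolding T_def
      by (rule subproblem_sublevel_bound[OF lower \<mu> i P1x E xy g ny that])
    have "{w. ?S w \<le> ?S (x k)} \<subseteq> cball (yt k i) T"
      using bound by (auto simp: dist_norm norm_minus_commute)
    then have "bounded {w. ?S w \<le> ?S (x k)}"
      using bounded_cball bounded_subset by blast
    from closed_fun_attains_min[OF closed_subproblem this]
    have "\<exists>w. is_arg_min ?S (\<lambda>_. True) w" by (simp add: is_arg_min_linorder)
    then show ?thesis using bound by (auto simp: is_arg_min_linorder)
  qed
  then show ?thesis by blast
qed

text \<open>Two thresholds: a large \<gamma> absorbs the Lipschitz error of \<open>grad f\<close> on
  a ball that holds all trial minimizers, a large trial index makes the extrapolation error smaller
  than the reserve contained in \<open>R k\<close>.\<close>

lemma line_search_accepts_large_parameter: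
  "\<exists>\<Gamma> i0. \<forall>k i w. x k \<in> cball z 1 \<longrightarrow> x (k - 1) \<in> cball z 1 \<longrightarrow> \<Gamma> \<le> \<gamma>t k i \<longrightarrow> i0 \<le> i \<longrightarrow>
    is_arg_min (subproblem f P1 (\<xi> k) (yt k i) (\<gamma>t k i)) (\<lambda>_. True) w \<longrightarrow>
    line_search \<delta> F (R k) (\<gamma>t k i) (x k) w"
proof -
  obtain \<Gamma> T where T: "\<And>k i w. x k \<in> cball z 1 \<Longrightarrow> x (k - 1) \<in> cball z 1 \<Longrightarrow> \<Gamma> \<le> \<gamma>t k i \<Longrightarrow>
      is_arg_min (subproblem f P1 (\<xi> k) (yt k i) (\<gamma>t k i)) (\<lambda>_. True) w \<Longrightarrow> norm (w - yt k i) \<le> T"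
    using trial_minimizer_near[of z] by blast
  define \<rho> where "\<rho> = 1 + 2 * \<beta>max + \<bar>T\<bar>"
  obtain L where L: "0 < L" "L-lipschitz_on (cball z \<rho>) (grad f)"
    using locally_lipschitz_imp_lipschitz_cball[OF f_grad_lipschitz] by blast
  have "(\<lambda>i. (\<tau> * \<eta>\<^sup>2) ^ i * (\<gamma>max * \<beta>max\<^sup>2)) \<longlonglongrightarrow> 0 * (\<gamma>max * \<beta>max\<^sup>2)"
    using \<tau>\<eta>_less_1 by (intro tendsto_intros LIMSEQ_power_zero) auto
  \<comment> \<open>The error enters with the factor 2 against the reserve \<delta> * \<gamma>min /
    8, hence 1/16.\<close>
  then have "\<forall>\<^sub>F i in sequentially. (\<tau> * \<eta>\<^sup>2) ^ i * (\<gamma>max * \<beta>max\<^sup>2) < \<gamma>min / 16"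
    using params by (intro order_tendstoD(2)) auto
  then obtain i0 where i0: "\<And>i. i0 \<le> i \<Longrightarrow> (\<tau> * \<eta>\<^sup>2) ^ i * (\<gamma>max * \<beta>max\<^sup>2) < \<gamma>min / 16"
    by (auto simp: eventually_sequentially)
  have "line_search \<delta> F (R k) (\<gamma>t k i) (x k) w"
    if k: "x k \<in> cball z 1" "x (k - 1) \<in> cball z 1" and \<gamma>: "max \<Gamma> (12 * L) \<le> \<gamma>t k i" and i: "i0 \<le> i"
      and w: "is_arg_min (subproblem f P1 (\<xi> k) (yt k i) (\<gamma>t k i)) (\<lambda>_. True) w" for k i w
  proof -
    let ?e = "norm (x k - x (k - 1))"
    have y: "dist z (yt k i) \<le> 1 + 2 * \<beta>max" using trial_point_near(3)[OF k, of i] by simp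
    have "norm (w - yt k i) \<le> T" using T[OF k _ w] \<gamma> by simp
    then have w': "w \<in> cball z \<rho>"
      using y dist_triangle[of z w "yt k i"] by (simp add: \<rho>_def dist_norm norm_minus_commute)
    have y': "yt k i \<in> cball z \<rho>" and x': "x k \<in> cball z \<rho>"
      using y k(1) params by (auto simp: \<rho>_def)
    have min: "subproblem f P1 (\<xi> k) (yt k i) (\<gamma>t k i) w \<le> subproblem f P1 (\<xi> k) (yt k i) (\<gamma>t k i) (x k)"
      using w by (simp add: is_arg_min_linorder)
    obtain pw where pw: "P1 w = ereal pw"
      using min P1_not_MInf[of w] by (cases "P1 w") (auto simp: subproblem_def P1_x)
    have "f w + pw - P2 w + \<gamma>t k i / 8 * (norm (w - x k))\<^sup>2
        \<le> f (x k) + (Fr k - f (x k) + P2 (x k)) - P2 (x k) + 2 * \<gamma>t k i * (norm (x k - yt k i))\<^sup>2"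
    proof (rule extrapolated_step_descent)
      show "f w - f (x k) - grad f (yt k i) \<bullet> (w - x k)
          \<le> L * (norm (w - x k) + norm (x k - yt k i)) * norm (w - x k)"
        by (rule increment_le_grad_lipschitz[OF f_differentiable L(2) convex_cball x' w' y'])
      show "P2 (x k) + \<xi> k \<bullet> (w - x k) \<le> P2 w" by (rule \<xi>_subgradient)
      show "(grad f (yt k i) - \<xi> k) \<bullet> (w - yt k i) + \<gamma>t k i / 2 * (norm (w - yt k i))\<^sup>2 + pw
        \<le> (grad f (yt k i) - \<xi> k) \<bullet> (x k - yt k i) + \<gamma>t k i / 2 * (norm (x k - yt k i))\<^sup>2
          + (Fr k - f (x k) + P2 (x k))"
        using min by (simp add: subproblem_def pw P1_x)
    qed (use L \<gamma> in auto)
    moreover have "2 * \<gamma>t k i * (norm (x k - yt k i))\<^sup>2 \<le> \<delta> * \<gamma>min / 8 * ?e\<^sup>2"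
    proof -
      have "2 * (\<gamma>t k i * (norm (x k - yt k i))\<^sup>2)
          \<le> 2 * ((\<tau> * \<eta>\<^sup>2) ^ i * (\<gamma>max * \<delta> * \<beta>max\<^sup>2) * ?e\<^sup>2)"
        using trial_extrapolation[of k i] by simp
      also have "\<dots> = \<delta> * ((\<tau> * \<eta>\<^sup>2) ^ i * (\<gamma>max * \<beta>max\<^sup>2)) * (2 * ?e\<^sup>2)"
        by simp
      also have "\<dots> \<le> \<delta> * (\<gamma>min / 16) * (2 * ?e\<^sup>2)"
        using i0[OF i] params by (intro mult_right_mono mult_left_mono) auto
      finally show ?thesis by simp
    qed
    ultimately have "f w + pw - P2 w + \<gamma>t k i / 8 * (norm (w - x k))\<^sup>2 \<le> R k"
      using previous_step_le_R[of k] by linarith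
    \<comment> \<open>The descent \<gamma> / 8 splits into \<delta> * \<gamma> / 8 inside the
      potential and (1 - \<delta>) * \<gamma> / 8 on the right of the criterion.\<close>
    then show ?thesis
      by (simp add: line_search_def potential_def objective_def pw field_simps)
  qed
  then show ?thesis by blast
qed

text \<open>The trial just before the accepted one has failed; yet with a large accepted parameter
  its subproblem would have had minimizers, all of them passing the line search.\<close>

lemma \<gamma>b_locally_bounded:
  "\<exists>\<Gamma>. \<forall>k. x k \<in> cball z 1 \<longrightarrow> x (k - 1) \<in> cball z 1 \<longrightarrow> \<gamma>b k \<le> \<Gamma>"
proof -
  obtain \<Gamma>1 where 1: "\<And>k i. x k \<in> cball z 1 \<Longrightarrow> x (k - 1) \<in> cball z 1 \<Longrightarrow> \<Gamma>1 \<le> \<gamma>t k i \<Longrightarrow>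
      \<exists>w. is_arg_min (subproblem f P1 (\<xi> k) (yt k i) (\<gamma>t k i)) (\<lambda>_. True) w"
    using trial_minimizer_near[of z] by blast
  obtain \<Gamma>2 i0 where 2: "\<And>k i w. x k \<in> cball z 1 \<Longrightarrow> x (k - 1) \<in> cball z 1 \<Longrightarrow> \<Gamma>2 \<le> \<gamma>t k i \<Longrightarrow> i0 \<le> i \<Longrightarrow>
      is_arg_min (subproblem f P1 (\<xi> k) (yt k i) (\<gamma>t k i)) (\<lambda>_. True) w \<Longrightarrow>
      line_search \<delta> F (R k) (\<gamma>t k i) (x k) w"
    using line_search_accepts_large_parameter[of z] by blast
  \<comment> \<open>Exceeding the first entry forces \<open>i0 < J k\<close>; exceeding the second
    leaves the preceding parameter, smaller by the factor \<tau>, above both thresholds.\<close>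
  define \<Gamma> where "\<Gamma> = max (\<tau> ^ i0 * \<gamma>max) (\<tau> * max \<Gamma>1 \<Gamma>2)"
  have "\<gamma>b k \<le> \<Gamma>" if k: "x k \<in> cball z 1" "x (k - 1) \<in> cball z 1" for k
  proof (rule ccontr)
    assume "\<not> \<gamma>b k \<le> \<Gamma>"
    then have big: "\<tau> ^ i0 * \<gamma>max < \<gamma>b k" "\<tau> * max \<Gamma>1 \<Gamma>2 < \<gamma>b k" by (auto simp: \<Gamma>_def)
    have "i0 < J k"
    proof (rule ccontr)
      assume "\<not> i0 < J k"
      then have "\<gamma>b k \<le> \<tau> ^ i0 * \<gamma>max"
        unfolding \<gamma>b_def using params \<gamma>0[of k] by (intro mult_mono power_increasing) auto
      then show False using big by simp
    qed
    then obtain i where i: "J k = Suc i" "i0 \<le> i" by (cases "J k") auto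
    have "\<gamma>b k = \<tau> * \<gamma>t k i" by (simp add: \<gamma>b_def \<gamma>t_def i)
    then have "max \<Gamma>1 \<Gamma>2 < \<gamma>t k i" using big(2) params by simp
    then have ge: "\<Gamma>1 \<le> \<gamma>t k i" "\<Gamma>2 \<le> \<gamma>t k i" by auto
    have "i < J k" by (simp add: i)
    from failed[OF this, folded yt_def \<gamma>t_def] 1[OF k ge(1)] 2[OF k ge(2) i(2)]
    show False by blast
  qed
  then show ?thesis by blast
qed


section \<open>Stationarity of accumulation points\<close>

text \<open>The negative gradient, at the accepted point, of the smooth part of the subproblem; by
  Fermat's rule a subgradient of \<open>P1\<close> there.\<close>

definition "v k = - (grad f (yb k) - \<xi> k + \<gamma>b k *\<^sub>R (x (Suc k) - yb k))"

lemma accepted_minimizer: "subproblem f P1 (\<xi> k) (yb k) (\<gamma>b k) (x (Suc k)) \<le> subproblem f P1 (\<xi> k) (yb k) (\<gamma>b k) z"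
  using accepted(1)[of k] by (simp add: is_arg_min_linorder yb_def \<gamma>b_def)

lemma v_frechet_subdiff: "v k \<in> frechet_subdiff P1 (x (Suc k))"
  unfolding v_def
proof (rule frechet_subdiff_of_smooth_minimizer[where h = P1 and w = "x (Suc k)" and
      q = "\<lambda>z. (grad f (yb k) - \<xi> k) \<bullet> (z - yb k) + \<gamma>b k / 2 * (norm (z - yb k))\<^sup>2", OF _ _ P1_x])
  show "ereal ((grad f (yb k) - \<xi> k) \<bullet> (x (Suc k) - yb k) + \<gamma>b k / 2 * (norm (x (Suc k) - yb k))\<^sup>2) + P1 (x (Suc k))
    \<le> ereal ((grad f (yb k) - \<xi> k) \<bullet> (z - yb k) + \<gamma>b k / 2 * (norm (z - yb k))\<^sup>2) + P1 z" for z
    using accepted_minimizer[of k z] by (simp add: subproblem_def)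
  show "((\<lambda>z. (grad f (yb k) - \<xi> k) \<bullet> (z - yb k) + \<gamma>b k / 2 * (norm (z - yb k))\<^sup>2) has_derivative
      (\<lambda>u. (grad f (yb k) - \<xi> k + \<gamma>b k *\<^sub>R (x (Suc k) - yb k)) \<bullet> u)) (at (x (Suc k)))"
    unfolding power2_norm_eq_inner
    by (auto intro!: derivative_eq_intros simp: inner_add_left inner_add_right inner_commute fun_eq_iff)
qed

text \<open>An inequality because of \<open>k = 0\<close>, where the left side is 0 and the right
  side is \<open>d 0\<close>.\<close>

lemma last_step_le: "norm (x k - x (k - 1)) \<le> d (k - 1)"
  by (cases k) (auto simp: d_def)

lemma yb_near: "norm (x k - yb k) \<le> \<beta>max * d (k - 1)"
proof -
  have "norm (x k - yb k) = (\<eta> ^ J k * \<beta>0 k) * norm (x k - x (k - 1))"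
    using \<beta>_trial(1)[of "J k" k] by (simp add: yb_def)
  also have "\<dots> \<le> \<beta>max * d (k - 1)"
    using last_step_le \<beta>_trial[of "J k" k] params by (intro mult_mono) auto
  finally show ?thesis .
qed

lemma next_yb_near: "norm (x (Suc k) - yb k) \<le> d k + \<beta>max * d (k - 1)"
  using yb_near[of k] norm_triangle_ineq[of "x (Suc k) - x k" "x k - yb k"] by (simp add: d_def)

lemma previous_d_tendsto_0: "(\<lambda>k. d (k - 1)) \<longlonglongrightarrow> 0"
  by (rule filterlim_compose[OF d_tendsto_0 filterlim_minus_const_nat_at_top])

text \<open>Local boundedness of convex subgradients makes \<xi> converge along a further
  subsequence; initial terms are dropped so that each iterate and its predecessor lie in the ball
  where \<gamma>b is bounded.\<close>

lemma accumulation_point_subsequence: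
  assumes r: "strict_mono r" "(x \<circ> r) \<longlonglongrightarrow> z"
  obtains n \<xi>s where "strict_mono n" "(\<lambda>j. x (n j)) \<longlonglongrightarrow> z" "(\<lambda>j. \<xi> (n j)) \<longlonglongrightarrow> \<xi>s"
    "\<And>j. x (n j) \<in> cball z 1" "\<And>j. x (n j - 1) \<in> cball z 1"
proof -
  have xr: "(\<lambda>j. x (r j)) \<longlonglongrightarrow> z" using r(2) by (simp add: o_def)
  have "(\<lambda>j. d (r j - 1)) \<longlonglongrightarrow> 0"
    by (rule filterlim_compose[OF previous_d_tendsto_0 filterlim_subseq[OF r(1)]])
  then have "(\<lambda>j. x (r j) - x (r j - 1)) \<longlonglongrightarrow> 0"
    by (rule Lim_null_comparison[rotated]) (use last_step_le in auto)
  from tendsto_diff[OF xr this] have "(\<lambda>j. x (r j - 1)) \<longlonglongrightarrow> z" by simp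
  then have "\<forall>\<^sub>F j in sequentially. dist (x (r j)) z < 1 \<and> dist (x (r j - 1)) z < 1"
    using tendstoD[OF xr, of 1] tendstoD[of "\<lambda>j. x (r j - 1)" z _ 1] by (auto intro: eventually_conj)
  then obtain N where N: "\<And>j. N \<le> j \<Longrightarrow> dist (x (r j)) z < 1 \<and> dist (x (r j - 1)) z < 1"
    by (auto simp: eventually_sequentially)
  obtain M where M: "\<And>k. x k \<in> cball z 1 \<Longrightarrow> norm (\<xi> k) \<le> M"
    using convex_subgradients_bounded[OF P2_convex, of z 1] \<xi>_subgradient by blast
  have "norm (\<xi> (r (j + N))) \<le> M" for j
    using N[of "j + N"] by (intro M) (auto simp: dist_commute)
  then have "bounded (range (\<lambda>j. \<xi> (r (j + N))))" by (auto simp: bounded_iff)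
  from bounded_imp_convergent_subsequence[OF this] obtain \<xi>s s where
    s: "strict_mono s" "(\<lambda>j. \<xi> (r (s j + N))) \<longlonglongrightarrow> \<xi>s" by (auto simp: o_def)
  have n: "strict_mono (\<lambda>j. r (s j + N))"
    using r(1) s(1) by (auto simp: strict_mono_def)
  have "filterlim (\<lambda>j. s j + N) sequentially sequentially"
    by (rule filterlim_compose[OF filterlim_add_const_nat_at_top filterlim_subseq[OF s(1)]])
  then have "(\<lambda>j. x (r (s j + N))) \<longlonglongrightarrow> z" by (rule filterlim_compose[OF xr])
  then show ?thesis
    using N by (intro that[OF n _ s(2)]) (auto simp: dist_commute intro: less_imp_le)
qed

text \<open>Boundedness of \<gamma>b makes the proximal terms vanish. The delicate part is the
  convergence of the \<open>P1\<close>-values to \<open>P1 z\<close>, which the limiting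
  subdifferential demands and lower semicontinuity does not give.\<close>

lemma accumulation_point_stationary:
  assumes r: "strict_mono r" "(x \<circ> r) \<longlonglongrightarrow> z"
  shows "F z = ereal \<zeta>" "z \<in> stationary_points f P1 P2"
proof -
  obtain n \<xi>s where n: "strict_mono n" "(\<lambda>j. x (n j)) \<longlonglongrightarrow> z" "(\<lambda>j. \<xi> (n j)) \<longlonglongrightarrow> \<xi>s"
    "\<And>j. x (n j) \<in> cball z 1" "\<And>j. x (n j - 1) \<in> cball z 1"
    using accumulation_point_subsequence[OF r] by blast
  obtain \<Gamma> where \<Gamma>: "\<And>j. \<gamma>b (n j) \<le> \<Gamma>"
    using \<gamma>b_locally_bounded[of z] n(4,5) by blast
  have fn: "filterlim n sequentially sequentially" by (rule filterlim_subseq[OF n(1)])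
  have "(\<lambda>j. x (Suc (n j)) - x (n j)) \<longlonglongrightarrow> 0"
    using filterlim_compose[OF d_tendsto_0 fn] by (rule Lim_null_comparison[rotated]) (simp add: d_def)
  from tendsto_add[OF this n(2)] have xs: "(\<lambda>j. x (Suc (n j))) \<longlonglongrightarrow> z" by simp
  have "(\<lambda>j. \<beta>max * d (n j - 1)) \<longlonglongrightarrow> \<beta>max * 0"
    by (intro tendsto_intros filterlim_compose[OF previous_d_tendsto_0 fn])
  then have "(\<lambda>j. \<beta>max * d (n j - 1)) \<longlonglongrightarrow> 0" by simp
  then have "(\<lambda>j. x (n j) - yb (n j)) \<longlonglongrightarrow> 0"
    by (rule Lim_null_comparison[rotated]) (use yb_near in auto)
  from tendsto_diff[OF n(2) this] have y: "(\<lambda>j. yb (n j)) \<longlonglongrightarrow> z" by simp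
  note gy = isCont_tendsto_compose[OF isCont_grad_f y]
  have "(\<lambda>j. \<Gamma> * norm (x (Suc (n j)) - yb (n j))) \<longlonglongrightarrow> \<Gamma> * norm (z - z)"
    by (intro tendsto_intros xs y)
  then have "(\<lambda>j. \<Gamma> * norm (x (Suc (n j)) - yb (n j))) \<longlonglongrightarrow> 0" by simp
  then have prox0: "(\<lambda>j. \<gamma>b (n j) *\<^sub>R (x (Suc (n j)) - yb (n j))) \<longlonglongrightarrow> 0"
  proof (rule Lim_null_comparison[rotated], intro always_eventually allI)
    fix j show "norm (\<gamma>b (n j) *\<^sub>R (x (Suc (n j)) - yb (n j))) \<le> \<Gamma> * norm (x (Suc (n j)) - yb (n j))"
      using \<Gamma>[of j] \<gamma>b_pos[of "n j"] by (simp add: mult_right_mono)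
  qed
  have v: "(\<lambda>j. v (n j)) \<longlonglongrightarrow> - (grad f z - \<xi>s + 0)"
    unfolding v_def by (intro tendsto_intros gy n(3) prox0)
  define c where "c = \<zeta> - f z + P2 z"
  have P1r: "(\<lambda>j. Fr (Suc (n j)) - f (x (Suc (n j))) + P2 (x (Suc (n j)))) \<longlonglongrightarrow> c"
    unfolding c_def
    by (intro tendsto_intros filterlim_compose[OF LIMSEQ_Suc[OF Fr_tendsto] fn]
        isCont_tendsto_compose[OF isCont_f xs] isCont_tendsto_compose[OF isCont_P2 xs])
  then have P1lim: "(\<lambda>j. P1 (x (Suc (n j)))) \<longlonglongrightarrow> ereal c"
    unfolding P1_x by simp
  then have "P1 z \<le> ereal c"
    by (rule closed_fun_le_of_tendsto[OF P1_closed xs]) simp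
  then obtain c' where c': "P1 z = ereal c'" "c' \<le> c"
    using P1_not_MInf[of z] by (cases "P1 z") auto
  \<comment> \<open>The reverse inequality: the accepted point does at least as well as
    \<open>z\<close> in its own subproblem. Dropping the proximal term on the left and putting
    \<Gamma> for the parameter on the right leaves two convergent sequences.\<close>
  have "c \<le> c'"
  proof -
    have "(grad f (yb (n j)) - \<xi> (n j)) \<bullet> (x (Suc (n j)) - yb (n j))
        + (Fr (Suc (n j)) - f (x (Suc (n j))) + P2 (x (Suc (n j))))
        \<le> (grad f (yb (n j)) - \<xi> (n j)) \<bullet> (z - yb (n j)) + \<Gamma> / 2 * (norm (z - yb (n j)))\<^sup>2 + c'" for j
    proof -
      have "0 \<le> \<gamma>b (n j) / 2 * (norm (x (Suc (n j)) - yb (n j)))\<^sup>2"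
        using \<gamma>b_pos[of "n j"] by simp
      moreover have "\<gamma>b (n j) / 2 * (norm (z - yb (n j)))\<^sup>2 \<le> \<Gamma> / 2 * (norm (z - yb (n j)))\<^sup>2"
        using \<Gamma>[of j] by (intro mult_right_mono) auto
      moreover have "(grad f (yb (n j)) - \<xi> (n j)) \<bullet> (x (Suc (n j)) - yb (n j))
        + \<gamma>b (n j) / 2 * (norm (x (Suc (n j)) - yb (n j)))\<^sup>2
        + (Fr (Suc (n j)) - f (x (Suc (n j))) + P2 (x (Suc (n j))))
        \<le> (grad f (yb (n j)) - \<xi> (n j)) \<bullet> (z - yb (n j))
          + \<gamma>b (n j) / 2 * (norm (z - yb (n j)))\<^sup>2 + c'"
        using accepted_minimizer[of "n j" z] unfolding subproblem_def P1_x c'(1) plus_ereal.simps(1)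
        by simp
      ultimately show ?thesis by linarith
    qed
    moreover have "(\<lambda>j. (grad f (yb (n j)) - \<xi> (n j)) \<bullet> (x (Suc (n j)) - yb (n j))
        + (Fr (Suc (n j)) - f (x (Suc (n j))) + P2 (x (Suc (n j))))) \<longlonglongrightarrow> (grad f z - \<xi>s) \<bullet> (z - z) + c"
      by (intro tendsto_add P1r tendsto_inner tendsto_diff gy n(3) xs y)
    moreover have "(\<lambda>j. (grad f (yb (n j)) - \<xi> (n j)) \<bullet> (z - yb (n j)) + \<Gamma> / 2 * (norm (z - yb (n j)))\<^sup>2 + c')
        \<longlonglongrightarrow> (grad f z - \<xi>s) \<bullet> (z - z) + \<Gamma> / 2 * (norm (z - z))\<^sup>2 + c'"
      by (intro tendsto_intros gy n(3) y)
    ultimately have "(grad f z - \<xi>s) \<bullet> (z - z) + c \<le> (grad f z - \<xi>s) \<bullet> (z - z) + \<Gamma> / 2 * (norm (z - z))\<^sup>2 + c'"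
      using LIMSEQ_le by blast
    then show ?thesis by simp
  qed
  then have P1z: "P1 z = ereal c" using c' by simp
  then show Fz: "F z = ereal \<zeta>" by (simp add: objective_def c_def)
  have "- (grad f z - \<xi>s) \<in> limiting_subdiff P1 z"
    unfolding limiting_subdiff_def
    by (intro CollectI conjI exI[of _ "\<lambda>j. x (Suc (n j))"] exI[of _ "\<lambda>j. v (n j)"] xs)
       (use P1lim v v_frechet_subdiff P1z in \<open>auto simp: edom_def\<close>)
  moreover have "\<xi>s \<in> limiting_subdiff (\<lambda>u. ereal (P2 u)) z"
    unfolding limiting_subdiff_convex_iff[OF P2_convex]
  proof
    fix u
    have "(\<lambda>j. P2 (x (n j)) + \<xi> (n j) \<bullet> (u - x (n j))) \<longlonglongrightarrow> P2 z + \<xi>s \<bullet> (u - z)"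
      by (intro tendsto_intros isCont_tendsto_compose[OF isCont_P2 n(2)] n)
    then show "P2 z + \<xi>s \<bullet> (u - z) \<le> P2 u"
      by (rule LIMSEQ_le_const2) (use \<xi>_subgradient in auto)
  qed
  ultimately show "z \<in> stationary_points f P1 P2"
    unfolding stationary_points_def using Fz by (force simp: edom_def)
qed

section \<open>Decrease near an accumulation point and rates\<close>

text \<open>Near \<open>z\<close> the subgradient \<open>\<xi> k\<close> is
  \<open>grad P2 (x k)\<close>, so inserting the optimality condition leaves gradient differences
  and proximal terms, all of the order of the last two steps.\<close>

lemma potential_subgradient_bound:
  assumes NS: "open NS" "z \<in> NS" "continuously_differentiable_on NS P2" "locally_lipschitz_on NS (grad P2)"
  shows "\<exists>\<epsilon>>0. \<exists>B>0. \<exists>\<Gamma>. \<forall>k. x (Suc k) \<in> ball z \<epsilon> \<longrightarrow> x k \<in> ball z \<epsilon> \<longrightarrow> x (k - 1) \<in> ball z \<epsilon> \<longrightarrow>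
    yb k \<in> ball z \<epsilon> \<longrightarrow> d k \<le> 1 \<longrightarrow> \<gamma>b k \<le> \<Gamma> \<and>
    (\<exists>D\<in>limiting_subdiff (potential \<delta> F) (x (Suc k), x k, \<gamma>b k). norm D \<le> B * (d k + d (k - 1)))"
proof -
  obtain \<Gamma> where \<Gamma>: "\<And>k. x k \<in> cball z 1 \<Longrightarrow> x (k - 1) \<in> cball z 1 \<Longrightarrow> \<gamma>b k \<le> \<Gamma>"
    using \<gamma>b_locally_bounded[of z] by blast
  obtain \<epsilon>1 L1 where 1: "0 < \<epsilon>1" "L1-lipschitz_on (ball z \<epsilon>1 \<inter> UNIV) (grad f)"
    using f_grad_lipschitz unfolding locally_lipschitz_on_def by blast
  obtain \<epsilon>2 L2 where 2: "0 < \<epsilon>2" "L2-lipschitz_on (ball z \<epsilon>2 \<inter> NS) (grad P2)"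
    using NS(2,4) unfolding locally_lipschitz_on_def by blast
  obtain \<epsilon>3 where 3: "0 < \<epsilon>3" "ball z \<epsilon>3 \<subseteq> NS"
    using NS(1,2) open_contains_ball by blast
  define \<epsilon> where "\<epsilon> = min 1 (min \<epsilon>1 (min \<epsilon>2 \<epsilon>3))"
  have \<epsilon>: "0 < \<epsilon>" "ball z \<epsilon> \<subseteq> cball z 1" "ball z \<epsilon> \<subseteq> ball z \<epsilon>1" "ball z \<epsilon> \<subseteq> ball z \<epsilon>2" "ball z \<epsilon> \<subseteq> NS"
    using 1(1) 2(1) 3 by (auto simp: \<epsilon>_def)
  have L: "0 \<le> L1" "0 \<le> L2" using 1(2) 2(2) lipschitz_on_nonneg by blast+
  \<comment> \<open>Collects \<open>L1\<close> and \<Gamma> times the distance to the extrapolated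
    point, \<open>L2\<close> and a share of \<Gamma> times the current step, and 1 for the
    \<gamma>-component.\<close>
  define B where "B = (L1 + \<bar>\<Gamma>\<bar>) * (1 + \<beta>max) + L2 + \<bar>\<Gamma>\<bar> + 1"
  have B: "0 < B" using L params by (simp add: B_def add_nonneg_pos)
  have "\<gamma>b k \<le> \<Gamma> \<and>
    (\<exists>D\<in>limiting_subdiff (potential \<delta> F) (x (Suc k), x k, \<gamma>b k). norm D \<le> B * (d k + d (k - 1)))"
    if k: "x (Suc k) \<in> ball z \<epsilon>" "x k \<in> ball z \<epsilon>" "x (k - 1) \<in> ball z \<epsilon>" "yb k \<in> ball z \<epsilon>" "d k \<le> 1" for k
  proof -
    have \<gamma>: "\<gamma>b k \<le> \<Gamma>" using k \<epsilon>(2) by (intro \<Gamma>) auto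
    have P2diff: "P2 differentiable (at u)" if "u \<in> ball z \<epsilon>" for u
      using that \<epsilon>(5) NS(3) by (auto simp: continuously_differentiable_on_def)
    have \<xi>_eq: "\<xi> k = grad P2 (x k)"
      by (rule convex_subgradient_eq_grad[OF \<xi>_subgradient P2diff[OF k(2)]])
    let ?a = "v k + grad f (x (Suc k)) - grad P2 (x (Suc k))"
    let ?b = "(\<delta> * \<gamma>b k / 4) *\<^sub>R (x (Suc k) - x k)"
    let ?c = "\<delta> / 8 * (norm (x (Suc k) - x k))\<^sup>2"
    let ?e = "d k + \<beta>max * d (k - 1)"
    have D: "(?a + ?b, - ?b, ?c) \<in> limiting_subdiff (potential \<delta> F) (x (Suc k), x k, \<gamma>b k)"
      using frechet_subdiff_potential[OF v_frechet_subdiff P1_x f_differentiable P2diff[OF k(1)],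
          where \<delta> = \<delta> and \<gamma> = "\<gamma>b k" and v = "x k"]
        frechet_subset_limiting_subdiff by blast
    let ?g = "grad f (x (Suc k)) - grad f (yb k)" and ?h = "grad P2 (x k) - grad P2 (x (Suc k))"
      and ?p = "\<gamma>b k *\<^sub>R (x (Suc k) - yb k)"
    have "?a = ?g + ?h - ?p" by (simp add: v_def \<xi>_eq algebra_simps)
    then have "norm ?a \<le> norm (?g + ?h) + norm ?p" using norm_triangle_ineq4 by metis
    also have "\<dots> \<le> norm ?g + norm ?h + \<gamma>b k * norm (x (Suc k) - yb k)"
      using norm_triangle_ineq[of ?g ?h] \<gamma>b_pos[of k] by simp
    also have "\<dots> \<le> L1 * ?e + L2 * d k + \<bar>\<Gamma>\<bar> * ?e"
    proof (intro add_mono)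
      have "norm (grad f (x (Suc k)) - grad f (yb k)) \<le> L1 * norm (x (Suc k) - yb k)"
        using lipschitz_on_normD[OF 1(2)] k \<epsilon>(3) by blast
      also have "\<dots> \<le> L1 * ?e" using L next_yb_near by (intro mult_left_mono) auto
      finally show "norm (grad f (x (Suc k)) - grad f (yb k)) \<le> L1 * ?e" .
      have "norm (grad P2 (x k) - grad P2 (x (Suc k))) \<le> L2 * norm (x k - x (Suc k))"
        using lipschitz_on_normD[OF 2(2)] k \<epsilon>(4,5) by blast
      then show "norm (grad P2 (x k) - grad P2 (x (Suc k))) \<le> L2 * d k"
        by (simp add: d_def norm_minus_commute)
      show "\<gamma>b k * norm (x (Suc k) - yb k) \<le> \<bar>\<Gamma>\<bar> * ?e"
        using \<gamma> \<gamma>b_pos[of k] next_yb_near[of k] by (intro mult_mono) auto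
    qed
    finally have a: "norm ?a \<le> L1 * ?e + L2 * d k + \<bar>\<Gamma>\<bar> * ?e" .
    have b: "norm ?b \<le> \<bar>\<Gamma>\<bar> / 4 * d k"
    proof -
      have "\<delta> * \<gamma>b k \<le> 1 * \<bar>\<Gamma>\<bar>" using \<gamma> \<gamma>b_pos[of k] params by (intro mult_mono) auto
      then show ?thesis
        using params \<gamma>b_pos[of k] d_nonneg[of k] by (simp add: d_def[symmetric] mult_right_mono)
    qed
    \<comment> \<open>Quadratic in the step, and made linear by \<open>d k \<le> 1\<close>.\<close>
    have c: "norm ?c \<le> d k"
    proof -
      have "\<delta> / 8 * (d k)\<^sup>2 \<le> 1 * (d k * 1)"
        unfolding power2_eq_square using params k(5) d_nonneg[of k] by (intro mult_mono) auto
      then show ?thesis using params by (simp add: d_def[symmetric])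
    qed
    have "norm (?a + ?b, - ?b, ?c) \<le> norm (?a + ?b) + (norm (- ?b) + norm ?c)"
      using norm_Pair_le[of "?a + ?b" "(- ?b, ?c)"] norm_Pair_le[of "- ?b" ?c] by linarith
    also have "\<dots> \<le> norm ?a + 2 * norm ?b + norm ?c"
      using norm_triangle_ineq[of ?a ?b] norm_minus_cancel[of ?b] by linarith
    also have "\<dots> \<le> (L1 * ?e + L2 * d k + \<bar>\<Gamma>\<bar> * ?e) + 2 * (\<bar>\<Gamma>\<bar> / 4 * d k) + d k"
      using a b c by linarith
    also have "\<dots> \<le> B * (d k + d (k - 1))"
    proof -
      have "?e \<le> (1 + \<beta>max) * (d k + d (k - 1))"
        using params d_nonneg[of k] d_nonneg[of "k - 1"] by (simp add: algebra_simps)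
      then have "(L1 + \<bar>\<Gamma>\<bar>) * ?e \<le> (L1 + \<bar>\<Gamma>\<bar>) * ((1 + \<beta>max) * (d k + d (k - 1)))"
        using L by (intro mult_left_mono) auto
      moreover have "(L2 + \<bar>\<Gamma>\<bar> + 1) * d k \<le> (L2 + \<bar>\<Gamma>\<bar> + 1) * (d k + d (k - 1))"
        using L d_nonneg[of "k - 1"] by (intro mult_left_mono) auto
      moreover have "0 \<le> \<bar>\<Gamma>\<bar> * d k" using d_nonneg by simp
      ultimately show ?thesis unfolding B_def ring_distribs by (simp add: mult.assoc)
    qed
    finally show ?thesis using D \<gamma> by blast
  qed
  then show ?thesis using \<epsilon>(1) B by blast
qed


lemma neighbours_near:
  assumes "0 < \<epsilon>"
  shows "\<exists>K. \<forall>k\<ge>K. x k \<in> ball z (\<epsilon> / 2) \<longrightarrow>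
    x (Suc k) \<in> ball z \<epsilon> \<and> x (k - 1) \<in> ball z \<epsilon> \<and> yb k \<in> ball z \<epsilon>"
proof -
  \<comment> \<open>Small enough for the plain steps and for extrapolation, which multiplies a step
    by at most \<beta>max.\<close>
  define e where "e = \<epsilon> / (2 * (1 + \<beta>max))"
  have e: "0 < e" "e \<le> \<epsilon> / 2" "\<beta>max * e < \<epsilon> / 2"
    using assms params by (auto simp: e_def field_simps)
  have "\<forall>\<^sub>F k in sequentially. d k < e \<and> d (k - 1) < e"
    using order_tendstoD(2)[OF d_tendsto_0 e(1)] order_tendstoD(2)[OF previous_d_tendsto_0 e(1)]
    by eventually_elim simp
  then obtain K where K: "\<And>k. K \<le> k \<Longrightarrow> d k < e \<and> d (k - 1) < e"
    by (auto simp: eventually_sequentially)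
  have "x (Suc k) \<in> ball z \<epsilon> \<and> x (k - 1) \<in> ball z \<epsilon> \<and> yb k \<in> ball z \<epsilon>"
    if "K \<le> k" "x k \<in> ball z (\<epsilon> / 2)" for k
  proof -
    have "dist (x k) (x (Suc k)) < \<epsilon> / 2"
      using K[OF that(1)] e(2) by (simp add: d_def dist_norm norm_minus_commute)
    moreover have "dist (x k) (x (k - 1)) < \<epsilon> / 2"
      using K[OF that(1)] e(2) last_step_le[of k] by (simp add: dist_norm)
    moreover have "dist (x k) (yb k) < \<epsilon> / 2"
    proof -
      have "\<beta>max * d (k - 1) \<le> \<beta>max * e"
        using K[OF that(1)] params by (intro mult_left_mono) auto
      then show ?thesis using yb_near[of k] e(3) by (simp add: dist_norm)
    qed
    ultimately show ?thesis
      using that(2) dist_triangle[of z _ "x k"] by (smt (verit) mem_ball field_sum_of_halves)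
  qed
  then show ?thesis by blast
qed

text \<open>Since \<open>max (Hr k - \<zeta>) 0\<close> does not exceed the current gap, the
  weighted mean is largest for the smallest weight, which may thus replace
  \<open>p k\<close>.\<close>

lemma averaged_gap:
  "R (Suc k) - \<zeta> \<le> (1 - pmin) * (R k - \<zeta>) + pmin * max (Hr k - \<zeta>) 0"
proof -
  let ?m = "max (Hr k - \<zeta>) 0"
  have "0 \<le> R k - \<zeta> - ?m" using Hr_le_R[of k] \<zeta>_le_R[of k] by auto
  then have "pmin * (R k - \<zeta> - ?m) \<le> p k * (R k - \<zeta> - ?m)"
    using p(1) by (rule mult_right_mono[rotated])
  moreover have "p k * (Hr k - \<zeta>) \<le> p k * ?m" using p_pos[of k] by (intro mult_left_mono) auto
  ultimately show ?thesis by (simp add: R_Suc_eq algebra_simps)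
qed

lemma local_decrease:
  assumes Fz: "F z = ereal \<zeta>"
    and NS: "open NS" "z \<in> NS" "continuously_differentiable_on NS P2" "locally_lipschitz_on NS (grad P2)"
    and \<theta>: "0 \<le> \<theta>" "\<theta> < 1"
    and KL: "\<And>\<gamma>. 0 < \<gamma> \<Longrightarrow> KL_at_with_exponent (potential \<delta> F) \<theta> (z, z, \<gamma>)"
  shows "\<exists>\<epsilon>>0. \<exists>c>0. \<exists>K\<ge>1. \<forall>k\<ge>K. x k \<in> ball z \<epsilon> \<longrightarrow>
    c * (R (k - 1) - \<zeta>) powr max 1 (2 * \<theta>) \<le> R (k - 1) - R (Suc k) \<and> (\<theta> = 0 \<longrightarrow> Hr k \<le> \<zeta>)"
proof -
  define s where "s = max 1 (2 * \<theta>)"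
  have s: "1 \<le> s" "2 * \<theta> \<le> s" by (auto simp: s_def)
  obtain \<epsilon>1 B \<Gamma> where 1: "0 < \<epsilon>1" "0 < B"
    "\<And>k. x (Suc k) \<in> ball z \<epsilon>1 \<Longrightarrow> x k \<in> ball z \<epsilon>1 \<Longrightarrow> x (k - 1) \<in> ball z \<epsilon>1 \<Longrightarrow>
      yb k \<in> ball z \<epsilon>1 \<Longrightarrow> d k \<le> 1 \<Longrightarrow> \<gamma>b k \<le> \<Gamma> \<and>
      (\<exists>D\<in>limiting_subdiff (potential \<delta> F) (x (Suc k), x k, \<gamma>b k). norm D \<le> B * (d k + d (k - 1)))"
    using potential_subgradient_bound[OF NS] by blast
  \<comment> \<open>The \<open>max\<close> keeps the parameter interval nonempty; \<gamma>min below
    and \<Gamma> above confine the parameters accepted near \<open>z\<close>.\<close>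
  have "\<exists>\<nu>>0. \<exists>c>0. \<exists>\<epsilon>>0. \<forall>u\<in>ball z \<epsilon>. \<forall>v\<in>ball z \<epsilon>. \<forall>\<gamma>\<in>{\<gamma>min..max \<gamma>min \<Gamma>}. \<forall>h D.
    potential \<delta> F (u, v, \<gamma>) = ereal h \<longrightarrow> \<zeta> < h \<longrightarrow> h < \<zeta> + \<nu> \<longrightarrow>
    D \<in> limiting_subdiff (potential \<delta> F) (u, v, \<gamma>) \<longrightarrow> c * (h - \<zeta>) powr \<theta> \<le> norm D"
  proof (rule KL_inequality_uniform)
    show "potential \<delta> F (z, z, \<gamma>) = ereal \<zeta>" for \<gamma> by (simp add: potential_def Fz)
  qed (use KL params \<theta> in auto)
  then obtain \<nu> c \<epsilon>2 where 2: "0 < \<nu>" "0 < c" "0 < \<epsilon>2" and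
    KL_bound: "\<forall>u\<in>ball z \<epsilon>2. \<forall>v\<in>ball z \<epsilon>2. \<forall>\<gamma>\<in>{\<gamma>min..max \<gamma>min \<Gamma>}. \<forall>h D.
      potential \<delta> F (u, v, \<gamma>) = ereal h \<longrightarrow> \<zeta> < h \<longrightarrow> h < \<zeta> + \<nu> \<longrightarrow>
      D \<in> limiting_subdiff (potential \<delta> F) (u, v, \<gamma>) \<longrightarrow> c * (h - \<zeta>) powr \<theta> \<le> norm D"
    by (elim exE conjE)
  define \<epsilon> where "\<epsilon> = min \<epsilon>1 \<epsilon>2"
  have \<epsilon>: "0 < \<epsilon>" "ball z \<epsilon> \<subseteq> ball z \<epsilon>1" "ball z \<epsilon> \<subseteq> ball z \<epsilon>2" using 1 2 by (auto simp: \<epsilon>_def)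
  obtain K1 where K1: "\<And>k. K1 \<le> k \<Longrightarrow> x k \<in> ball z (\<epsilon> / 2) \<Longrightarrow>
    x (Suc k) \<in> ball z \<epsilon> \<and> x (k - 1) \<in> ball z \<epsilon> \<and> yb k \<in> ball z \<epsilon>"
    using neighbours_near[OF \<epsilon>(1), of z] by blast
  have "(\<lambda>k. R (k - 1)) \<longlonglongrightarrow> \<zeta>"
    by (rule filterlim_compose[OF R_tendsto filterlim_minus_const_nat_at_top])
  \<comment> \<open>The bound \<nu> puts the potential values above \<zeta> into the KL range; the
    bound 1 lets a larger exponent give a smaller power.\<close>
  then have "\<forall>\<^sub>F k in sequentially. R (k - 1) < \<zeta> + min 1 \<nu>"
    using 2(1) by (intro order_tendstoD(2)) auto
  moreover have "\<forall>\<^sub>F k in sequentially. d k < 1"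
    by (rule order_tendstoD(2)[OF d_tendsto_0]) simp
  \<comment> \<open>This serves \<theta> = 0: there the KL inequality above \<zeta> reads c \<le> B
    * (d k + d (k - 1)), a contradiction, so \<open>Hr k \<le> \<zeta>\<close>.\<close>
  moreover have "\<forall>\<^sub>F k in sequentially. B * (d k + d (k - 1)) < c"
  proof (rule order_tendstoD(2))
    show "(\<lambda>k. B * (d k + d (k - 1))) \<longlonglongrightarrow> B * (0 + 0)"
      by (intro tendsto_intros d_tendsto_0 previous_d_tendsto_0)
  qed (use 2 in simp)
  ultimately have "\<forall>\<^sub>F k in sequentially. R (k - 1) < \<zeta> + min 1 \<nu> \<and> d k < 1 \<and> B * (d k + d (k - 1)) < c"
    by eventually_elim simp
  then obtain K2 where K2: "\<And>k. K2 \<le> k \<Longrightarrow> R (k - 1) < \<zeta> + min 1 \<nu> \<and> d k < 1 \<and> B * (d k + d (k - 1)) < c"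
    by (auto simp: eventually_sequentially)
  \<comment> \<open>The 2 comes from (a + b)^2 \<le> 2 * (a^2 + b^2), and 1 / \<kappa> converts
    squared steps into decreases of \<open>R\<close>.\<close>
  define C where "C = 2 * (B / c)\<^sup>2 / \<kappa>"
  define c' where "c' = min (pmin / 2) (1 / (C * 2 powr s))"
  have C: "0 < C" using 1 2 \<kappa>_pos by (simp add: C_def)
  have c': "0 < c'" using C params by (simp add: c'_def)
  have "c' * (R (k - 1) - \<zeta>) powr s \<le> R (k - 1) - R (Suc k) \<and> (\<theta> = 0 \<longrightarrow> Hr k \<le> \<zeta>)"
    if k: "max 1 (max K1 K2) \<le> k" "x k \<in> ball z (\<epsilon> / 2)" for k
  proof -
    have near: "x (Suc k) \<in> ball z \<epsilon>" "x (k - 1) \<in> ball z \<epsilon>" "yb k \<in> ball z \<epsilon>" "x k \<in> ball z \<epsilon>"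
      using K1[of k] k \<epsilon>(1) by auto
    have K: "R (k - 1) < \<zeta> + 1" "R (k - 1) < \<zeta> + \<nu>" "d k \<le> 1" "B * (d k + d (k - 1)) < c"
      using K2[of k] k(1) by auto
    obtain D where \<Gamma>: "\<gamma>b k \<le> \<Gamma>" and D: "D \<in> limiting_subdiff (potential \<delta> F) (x (Suc k), x k, \<gamma>b k)"
      "norm D \<le> B * (d k + d (k - 1))"
      using 1(3)[of k] near \<epsilon>(2) K(3) by blast
    have Rk: "R k \<le> R (k - 1)" using R_antimono by simp
    have KL': "c * (Hr k - \<zeta>) powr \<theta> \<le> B * (d k + d (k - 1))" if "\<zeta> < Hr k"
    proof -
      have "c * (Hr k - \<zeta>) powr \<theta> \<le> norm D"
        using that D(1) near \<epsilon>(3) \<Gamma> \<gamma>b_ge[of k] Hr_le_R[of k] Rk K(2)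
        by (intro KL_bound[rule_format, OF _ _ _ H_x]) auto
      then show ?thesis using D(2) by linarith
    qed
    have zero: "Hr k \<le> \<zeta>" if "\<theta> = 0"
      using KL' K(4) that by (cases "\<zeta> < Hr k") auto
    have "c' * (R (k - 1) - \<zeta>) powr s \<le> (R (k - 1) - \<zeta>) - (R (Suc k) - \<zeta>)"
      unfolding c'_def
    proof (rule reference_decrease[where ?r1.0 = "R k - \<zeta>" and h = "Hr k - \<zeta>"])
      assume h: "0 < Hr k - \<zeta>"
      have "(Hr k - \<zeta>) powr s \<le> (Hr k - \<zeta>) powr (2 * \<theta>)"
        using h s Hr_le_R[of k] Rk K(1) by (intro powr_mono') auto
      also have "\<dots> = ((Hr k - \<zeta>) powr \<theta>)\<^sup>2"
        by (simp add: power2_eq_square flip: powr_add)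
      also have "\<dots> \<le> (B / c * (d k + d (k - 1)))\<^sup>2"
        using KL' h 2(2) by (intro power_mono) (auto simp: field_simps)
      also have "\<dots> = (B / c)\<^sup>2 * (d k + d (k - 1))\<^sup>2" by (simp only: power_mult_distrib)
      also have "\<dots> \<le> (B / c)\<^sup>2 * (2 * ((d k)\<^sup>2 + (d (k - 1))\<^sup>2))"
        using zero_le_power2[of "d k - d (k - 1)"]
        by (intro mult_left_mono) (simp_all add: power2_eq_square algebra_simps)
      also have "\<dots> = 2 * (B / c)\<^sup>2 * ((d k)\<^sup>2 + (d (k - 1))\<^sup>2)" by (simp only: mult_ac)
      also have "2 * (B / c)\<^sup>2 = C * \<kappa>" using \<kappa>_pos by (simp add: C_def)
      also have "C * \<kappa> * ((d k)\<^sup>2 + (d (k - 1))\<^sup>2) = C * (\<kappa> * (d k)\<^sup>2 + \<kappa> * (d (k - 1))\<^sup>2)"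
        by (simp only: mult.assoc distrib_left)
      \<comment> \<open>The two decreases telescope because \<open>Suc (k - 1) = k\<close>, by
        \<open>k \<ge> 1\<close>.\<close>
      also have "\<dots> \<le> C * (R (k - 1) - \<zeta> - (R (Suc k) - \<zeta>))"
        using \<kappa>_step[of k] \<kappa>_step[of "k - 1"] k(1) C by (intro mult_left_mono) auto
      finally show "(Hr k - \<zeta>) powr s \<le> C * (R (k - 1) - \<zeta> - (R (Suc k) - \<zeta>))" .
    qed (use \<zeta>_le_R R_Suc_le Rk K(1) params s C averaged_gap in \<open>auto simp: less_imp_le\<close>)
    then show ?thesis using zero by simp
  qed
  moreover have "0 < \<epsilon> / 2" "1 \<le> max 1 (max K1 K2)" using \<epsilon>(1) by simp_all
  ultimately show ?thesis using c' unfolding s_def[symmetric] by blast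
qed

lemma global_decrease:
  assumes r: "strict_mono r" "(x \<circ> r) \<longlonglongrightarrow> z"
    and NS: "open NS" "z \<in> NS" "continuously_differentiable_on NS P2" "locally_lipschitz_on NS (grad P2)"
    and \<theta>: "0 \<le> \<theta>" "\<theta> < 1"
    and KL: "\<And>\<gamma>. 0 < \<gamma> \<Longrightarrow> KL_at_with_exponent (potential \<delta> F) \<theta> (z, z, \<gamma>)"
  shows "\<exists>c>0. \<exists>N. \<forall>k\<ge>N. c * (R k - \<zeta>) powr max 1 (2 * \<theta>) \<le> (R k - \<zeta>) - (R (k + 2) - \<zeta>) \<and>
    (\<theta> = 0 \<longrightarrow> Hr k \<le> \<zeta>)"
proof -
  define s where "s = max 1 (2 * \<theta>)"
  have s: "1 \<le> s" "s < 2" using \<theta> by (auto simp: s_def)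
  obtain \<epsilon> c K where loc: "0 < \<epsilon>" "0 < c" "1 \<le> K"
    "\<And>k. K \<le> k \<Longrightarrow> x k \<in> ball z \<epsilon> \<Longrightarrow> c * (R (k - 1) - \<zeta>) powr s \<le> R (k - 1) - R (Suc k)"
    "\<And>k. K \<le> k \<Longrightarrow> x k \<in> ball z \<epsilon> \<Longrightarrow> \<theta> = 0 \<Longrightarrow> Hr k \<le> \<zeta>"
    using local_decrease[OF accumulation_point_stationary(1)[OF r] NS \<theta> KL, folded s_def] by blast
  define \<psi> where "\<psi> k = (R k - \<zeta>) powr (1 - s / 2)" for k
  \<comment> \<open>Combines the constant of \<open>sqrt_decrease_le\<close> with the root of
    \<kappa> that \<open>\<kappa>_step\<close> contributes.\<close>
  define C where "C = 1 / (sqrt c * (1 - s / 2) * sqrt \<kappa>)"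
  have "\<exists>N\<ge>K. \<forall>k\<ge>N. x k \<in> ball z \<epsilon>"
  proof (rule finite_length_trapping[OF loc(1)])
    show "0 < C" using loc(2) s \<kappa>_pos by (simp add: C_def)
    have "(\<lambda>k. R k - \<zeta>) \<longlonglongrightarrow> 0"
      using R_tendsto by (simp add: LIM_zero)
    then show "\<psi> \<longlonglongrightarrow> 0"
      unfolding \<psi>_def using s \<zeta>_le_R by (intro tendsto_zero_powrI[OF _ tendsto_const]) auto
    show "\<exists>n\<ge>N. dist (x n) z < e" if e: "0 < e" for e N
    proof -
      obtain M where "\<And>j. M \<le> j \<Longrightarrow> dist (x (r j)) z < e"
        using tendstoD[OF r(2) e] by (auto simp: eventually_sequentially)
      then show ?thesis
        using seq_suble[OF r(1), of "max M N"] by (intro exI[of _ "r (max M N)"]) auto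
    qed
    show "norm (x (Suc k) - x k) \<le> C * (\<psi> (k - 1) - \<psi> (Suc k))" if k: "K \<le> k" "x k \<in> ball z \<epsilon>" for k
    proof -
      have Rk: "R k \<le> R (k - 1)" using R_antimono by simp
      have "sqrt \<kappa> * norm (x (Suc k) - x k) = sqrt (\<kappa> * (d k)\<^sup>2)"
        by (simp add: real_sqrt_mult d_def)
      also have "\<dots> \<le> sqrt ((R (k - 1) - \<zeta>) - (R (Suc k) - \<zeta>))"
        using \<kappa>_step[of k] Rk by simp
      also have "\<dots> \<le> (\<psi> (k - 1) - \<psi> (Suc k)) / (sqrt c * (1 - s / 2))"
        unfolding \<psi>_def using loc(2) loc(4)[OF k] \<zeta>_le_R s R_antimono[of "k - 1" "Suc k"]
        by (intro sqrt_decrease_le) auto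
      finally have "norm (x (Suc k) - x k) * sqrt \<kappa> \<le> (\<psi> (k - 1) - \<psi> (Suc k)) / (sqrt c * (1 - s / 2))"
        by (simp only: mult.commute)
      then have "norm (x (Suc k) - x k) \<le> (\<psi> (k - 1) - \<psi> (Suc k)) / (sqrt c * (1 - s / 2)) / sqrt \<kappa>"
        by (rule iffD2[OF pos_le_divide_eq, rotated]) (use \<kappa>_pos in simp)
      then show ?thesis by (simp add: C_def mult.assoc)
    qed
  qed (simp add: \<psi>_def)
  then obtain N where N: "K \<le> N" "\<And>k. N \<le> k \<Longrightarrow> x k \<in> ball z \<epsilon>" by blast
  \<comment> \<open>The decrease is the local estimate at \<open>Suc k\<close>, whereas the sign for
    \<theta> = 0 is the one at \<open>k\<close>.\<close>
  have "c * (R k - \<zeta>) powr s \<le> (R k - \<zeta>) - (R (k + 2) - \<zeta>) \<and> (\<theta> = 0 \<longrightarrow> Hr k \<le> \<zeta>)" if "N \<le> k" for k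
    using that N loc(4)[of "Suc k"] loc(5)[of k] by auto
  then show ?thesis using loc(2) unfolding s_def by blast
qed

lemma objective_rates:
  assumes r: "strict_mono r" "(x \<circ> r) \<longlonglongrightarrow> z"
    and NS: "open NS" "stationary_points f P1 P2 \<subseteq> NS"
      "continuously_differentiable_on NS P2" "locally_lipschitz_on NS (grad P2)"
    and \<theta>: "0 \<le> \<theta>" "\<theta> < 1"
    and KL: "KL_function_on_with_exponent {(u, v, \<gamma>). 0 < \<gamma>} (potential \<delta> F) \<theta>"
  shows "\<theta> \<le> 1 / 2 \<Longrightarrow> \<exists>c>0. \<exists>q\<in>{0<..<1}. \<forall>\<^sub>F k in sequentially. \<bar>Fr k - \<zeta>\<bar> \<le> c * q ^ k"
    and "\<theta> = 0 \<Longrightarrow> \<forall>\<^sub>F k in sequentially. Fr k \<le> \<zeta>"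
    and "1 / 2 < \<theta> \<Longrightarrow>
      \<exists>c>0. \<forall>\<^sub>F k in sequentially. \<bar>Fr k - \<zeta>\<bar> \<le> c * real k powr (- (1 / (2 * \<theta> - 1)))"
proof -
  have z: "z \<in> stationary_points f P1 P2" by (rule accumulation_point_stationary(2)[OF r])
  then have zNS: "z \<in> NS" using NS(2) by blast
  obtain v where v: "v \<in> limiting_subdiff P1 z"
    using z unfolding stationary_points_def by blast
  \<comment> \<open>Stationarity supplies \<open>v\<close>, hence a nonempty subdifferential of the
    potential at \<open>(z, z, \<gamma>)\<close> for every positive \<gamma>, so the KL hypothesis
    applies there.\<close>
  have "KL_at_with_exponent (potential \<delta> F) \<theta> (z, z, \<gamma>)" if "0 < \<gamma>" for \<gamma>
    using KL that limiting_subdiff_potential_nonempty[OF P1_not_MInf v f_C1 NS(1) zNS NS(3)]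
    unfolding KL_function_on_with_exponent_def by blast
  from global_decrease[OF r NS(1) zNS NS(3,4) \<theta> this]
  obtain c N where c: "0 < c"
    "\<And>k. N \<le> k \<Longrightarrow> c * (R k - \<zeta>) powr max 1 (2 * \<theta>) \<le> (R k - \<zeta>) - (R (k + 2) - \<zeta>)"
    "\<And>k. N \<le> k \<Longrightarrow> \<theta> = 0 \<Longrightarrow> Hr k \<le> \<zeta>"
    by blast
  define b where "b = pmin * (1 - \<delta>)"
  have b: "0 < b" using params by (simp add: b_def)
  show "\<exists>c>0. \<exists>q\<in>{0<..<1}. \<forall>\<^sub>F k in sequentially. \<bar>Fr k - \<zeta>\<bar> \<le> c * q ^ k" if "\<theta> \<le> 1 / 2"
  proof -
    have "\<exists>M>0. \<exists>q\<in>{0<..<1}. \<forall>k\<ge>N. R k - \<zeta> \<le> M * q ^ k"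
    proof (rule two_step_contraction_rate[OF _ c(1)])
      have "max 1 (2 * \<theta>) = 1" using \<open>\<theta> \<le> 1 / 2\<close> by simp
      then show "c * (R k - \<zeta>) \<le> (R k - \<zeta>) - (R (k + 2) - \<zeta>)" if "N \<le> k" for k
        using c(2)[OF that] \<zeta>_le_R[of k] by simp
    qed (use \<zeta>_le_R in simp)
    then obtain M q where M: "0 < M" "0 < q" "q < 1" "\<And>k. N \<le> k \<Longrightarrow> R k - \<zeta> \<le> M * q ^ k"
      by auto
    \<comment> \<open>\<open>Fr k\<close> is controlled by the gap one index earlier, which costs a
      factor 1 / q.\<close>
    have "\<bar>Fr k - \<zeta>\<bar> \<le> M / (b * q) * q ^ k" if k: "Suc N \<le> k" for k
    proof -
      obtain j where j: "k = Suc j" "N \<le> j" using k by (cases k) auto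
      have "\<bar>Fr k - \<zeta>\<bar> \<le> (R j - \<zeta>) / b" unfolding j b_def by (rule Fr_rate)
      also have "\<dots> \<le> M * q ^ j / b" using M(4)[OF j(2)] b by (intro divide_right_mono) auto
      also have "\<dots> = M / (b * q) * q ^ k" using M j b by simp
      finally show ?thesis .
    qed
    then show ?thesis using M b
      by (intro exI[of _ "M / (b * q)"] conjI bexI[of _ q]) (auto simp: eventually_sequentially)
  qed
  show "\<forall>\<^sub>F k in sequentially. Fr k \<le> \<zeta>" if "\<theta> = 0"
  proof -
    have "Fr k \<le> \<zeta>" if "Suc N \<le> k" for k
      using that c(3)[OF _ \<open>\<theta> = 0\<close>, of "k - 1"] Fr_le_Hr[of "k - 1"] by (cases k) auto
    then show ?thesis unfolding eventually_sequentially by blast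
  qed
  show "\<exists>c>0. \<forall>\<^sub>F k in sequentially. \<bar>Fr k - \<zeta>\<bar> \<le> c * real k powr (- (1 / (2 * \<theta> - 1)))" if "1 / 2 < \<theta>"
  proof -
    define \<sigma> where "\<sigma> = 1 / (2 * \<theta> - 1)"
    have \<sigma>: "0 < \<sigma>" using that by (simp add: \<sigma>_def)
    have "\<exists>M>0. \<forall>\<^sub>F k in sequentially. R k - \<zeta> \<le> M * real k powr (- (1 / (2 * \<theta> - 1)))"
    proof (rule two_step_sublinear_rate[OF _ _ c(1)])
      have "max 1 (2 * \<theta>) = 2 * \<theta>" using \<open>1 / 2 < \<theta>\<close> by simp
      then show "c * (R k - \<zeta>) powr (2 * \<theta>) \<le> (R k - \<zeta>) - (R (k + 2) - \<zeta>)" if "N \<le> k" for k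
        using c(2)[OF that] by simp
    qed (use \<zeta>_le_R R_Suc_le that in simp_all)
    then obtain M K where M: "0 < M" "\<And>k. K \<le> k \<Longrightarrow> R k - \<zeta> \<le> M * real k powr (- \<sigma>)"
      unfolding \<sigma>_def eventually_sequentially by auto
    \<comment> \<open>Here the shift costs 2 powr \<sigma>, as k - 1 \<ge> k / 2; starting at
      \<open>K + 2\<close> makes \<open>j\<close> positive.\<close>
    have "\<bar>Fr k - \<zeta>\<bar> \<le> (M * 2 powr \<sigma> / b) * real k powr (- \<sigma>)" if k: "K + 2 \<le> k" for k
    proof -
      obtain j where j: "k = Suc j" "K \<le> j" "1 \<le> j" using k by (cases k) auto
      have "\<bar>Fr k - \<zeta>\<bar> \<le> (R j - \<zeta>) / b" unfolding j b_def by (rule Fr_rate)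
      also have "\<dots> \<le> M * real j powr (- \<sigma>) / b" using M(2)[OF j(2)] b by (intro divide_right_mono) auto
      also have "\<dots> \<le> M * (real k / 2) powr (- \<sigma>) / b"
        using M(1) b \<sigma> j by (intro divide_right_mono mult_left_mono powr_mono2') auto
      also have "\<dots> = (M * 2 powr \<sigma> / b) * real k powr (- \<sigma>)"
        by (simp add: powr_divide powr_minus field_simps)
      finally show ?thesis .
    qed
    then show ?thesis using M(1) b unfolding \<sigma>_def[symmetric]
      by (intro exI[of _ "M * 2 powr \<sigma> / b"] conjI) (auto simp: eventually_sequentially)
  qed
qed

end

theorem theorem4p2:
  fixes f :: "real ^ 'n \<Rightarrow> real"
    and P1 :: "real ^ 'n \<Rightarrow> ereal"
    and P2 :: "real ^ 'n \<Rightarrow> real"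
    and NS :: "(real ^ 'n) set"
    and \<gamma>min \<gamma>max \<beta>max pmin \<delta> \<tau> \<eta> \<theta> \<zeta> :: real
    and x :: "nat \<Rightarrow> real ^ 'n"
    and R :: "nat \<Rightarrow> real"
    and xstar :: "real ^ 'n"
  defines "F \<equiv> objective f P1 P2"
    and "\<zeta> \<equiv> lim R"
  assumes f: "continuously_differentiable_on UNIV f" "locally_lipschitz_on UNIV (grad f)"
    and P1: "proper_fun P1" "closed_fun P1" "prox_bounded P1"
    and P2: "convex_on UNIV P2"
    and F_bounded_below: "\<exists>m::real. \<forall>u\<in>edom P1. ereal m \<le> F u"
    and NS: "open NS" "stationary_points f P1 P2 \<subseteq> NS"
      "continuously_differentiable_on NS P2" "locally_lipschitz_on NS (grad P2)"
    and params: "0 < \<gamma>min" "\<gamma>min \<le> \<gamma>max" "0 \<le> \<beta>max" "0 < pmin" "pmin < 1"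
      "0 \<le> \<delta>" "\<delta> < 1" "1 < \<tau>" "0 < \<eta>" "\<eta> < 1 / sqrt \<tau>"
    and run: "nexPGA f P1 P2 \<gamma>min \<gamma>max \<beta>max pmin \<delta> \<tau> \<eta> x R"
    and accumulation: "\<exists>r. strict_mono r \<and> (x \<circ> r) \<longlonglongrightarrow> xstar"
    and \<theta>: "0 \<le> \<theta>" "\<theta> < 1"
    and KL: "KL_function_on_with_exponent {(u, v, \<gamma>). 0 < \<gamma>} (potential \<delta> F) \<theta>"
  shows "convergent R \<and>
    (\<theta> = 0 \<longrightarrow> (\<exists>c1>0. \<exists>\<eta>1\<in>{0<..<1}. \<forall>\<^sub>F k in sequentially.
       ereal (\<zeta> - c1 * \<eta>1 ^ k) \<le> F (x k) \<and> F (x k) \<le> ereal \<zeta>)) \<and>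
    (\<theta> \<in> {0<..1/2} \<longrightarrow> (\<exists>c2>0. \<exists>\<eta>2\<in>{0<..<1}. \<forall>\<^sub>F k in sequentially.
       \<bar>F (x k) - ereal \<zeta>\<bar> \<le> ereal (c2 * \<eta>2 ^ k))) \<and>
    (\<theta> \<in> {1/2<..<1} \<longrightarrow> (\<exists>c3>0. \<forall>\<^sub>F k in sequentially.
       \<bar>F (x k) - ereal \<zeta>\<bar> \<le> ereal (c3 * real k powr (- (1 / (2 * \<theta> - 1))))))"
proof -
  obtain \<xi> \<beta>0 \<gamma>0 X J p where run':
    "\<And>k. \<xi> k \<in> limiting_subdiff (\<lambda>u. ereal (P2 u)) (x k)"
    "\<And>k. \<beta>0 k \<in> {0..\<delta> * \<beta>max}" "\<And>k. \<gamma>0 k \<in> {\<gamma>min..\<gamma>max}"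
    "\<And>k i. i < J k \<Longrightarrow>
      (\<nexists>w. is_arg_min (subproblem f P1 (\<xi> k) (x k + (\<eta> ^ i * \<beta>0 k) *\<^sub>R (x k - x (k - 1)))
         (\<tau> ^ i * \<gamma>0 k)) (\<lambda>_. True) w) \<or>
      is_arg_min (subproblem f P1 (\<xi> k) (x k + (\<eta> ^ i * \<beta>0 k) *\<^sub>R (x k - x (k - 1)))
         (\<tau> ^ i * \<gamma>0 k)) (\<lambda>_. True) (X k i) \<and>
         \<not> line_search \<delta> (objective f P1 P2) (R k) (\<tau> ^ i * \<gamma>0 k) (x k) (X k i)"
    "\<And>k. is_arg_min (subproblem f P1 (\<xi> k)
        (x k + (\<eta> ^ J k * \<beta>0 k) *\<^sub>R (x k - x (k - 1))) (\<tau> ^ J k * \<gamma>0 k)) (\<lambda>_. True) (X k (J k))"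
    "\<And>k. line_search \<delta> (objective f P1 P2) (R k) (\<tau> ^ J k * \<gamma>0 k) (x k) (X k (J k))"
    "\<And>k. x (Suc k) = X k (J k)" "\<And>k. p (Suc k) \<in> {pmin..1}"
    "\<And>k. ereal (R (Suc k)) = ereal ((1 - p (Suc k)) * R k)
        + ereal (p (Suc k)) * potential \<delta> (objective f P1 P2) (x (Suc k), x k, \<tau> ^ J k * \<gamma>0 k)"
    and x0: "x 0 \<in> edom P1" "ereal (R 0) = objective f P1 P2 (x 0)"
    using run unfolding nexPGA_def Let_def by blast
  \<comment> \<open>The weights are shifted by one. The trial points \<open>X\<close> disappear:
    accepted ones are \<open>x (Suc k)\<close>, rejected ones stay under an existential
    quantifier.\<close>
  interpret run: nexPGA_run f P2 P1 \<gamma>min \<gamma>max \<beta>max pmin \<delta> \<tau> \<eta> x \<xi> R \<beta>0 \<gamma>0 "\<lambda>k. p (Suc k)" J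
  proof
    fix k i assume "i < J k"
    from run'(4)[OF this] show "(\<nexists>w. is_arg_min (subproblem f P1 (\<xi> k)
         (x k + (\<eta> ^ i * \<beta>0 k) *\<^sub>R (x k - x (k - 1))) (\<tau> ^ i * \<gamma>0 k)) (\<lambda>_. True) w) \<or>
      (\<exists>w. is_arg_min (subproblem f P1 (\<xi> k) (x k + (\<eta> ^ i * \<beta>0 k) *\<^sub>R (x k - x (k - 1)))
         (\<tau> ^ i * \<gamma>0 k)) (\<lambda>_. True) w \<and>
         \<not> line_search \<delta> (objective f P1 P2) (R k) (\<tau> ^ i * \<gamma>0 k) (x k) w)"
      by blast
  qed (use f P1 P2 F_bounded_below[unfolded F_def] params run'(1-3,8,9) run'(5,6)[folded run'(7)] x0
      in \<open>simp_all only: atLeastAtMost_iff\<close>)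
  have \<zeta>: "run.\<zeta> = \<zeta>" by (simp add: run.\<zeta>_def \<zeta>_def)
  obtain r where r: "strict_mono r" "(x \<circ> r) \<longlonglongrightarrow> xstar" using accumulation by blast
  note rates = run.objective_rates[OF r NS \<theta> KL[unfolded F_def], unfolded \<zeta>]
  have F: "F (x k) = ereal (run.Fr k)" for k unfolding F_def by (rule run.F_x)
  show ?thesis
  proof (intro conjI impI)
    show "convergent R" by (rule run.R_convergent)
  next
    assume \<theta>0: "\<theta> = 0"
    then obtain c q where cq: "0 < c" "q \<in> {0<..<1}"
      "\<forall>\<^sub>F k in sequentially. \<bar>run.Fr k - \<zeta>\<bar> \<le> c * q ^ k"
      using rates(1) by auto
    \<comment> \<open>The geometric rate for \<theta> \<le> 1/2 includes \<theta> = 0 and gives the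
      lower bound; the upper bound is the eventual sign of F (x k) - \<zeta>.\<close>
    from cq(3) rates(2)[OF \<theta>0] have "\<forall>\<^sub>F k in sequentially.
       ereal (\<zeta> - c * q ^ k) \<le> F (x k) \<and> F (x k) \<le> ereal \<zeta>"
      by eventually_elim (auto simp: F)
    then show "\<exists>c1>0. \<exists>\<eta>1\<in>{0<..<1}. \<forall>\<^sub>F k in sequentially.
       ereal (\<zeta> - c1 * \<eta>1 ^ k) \<le> F (x k) \<and> F (x k) \<le> ereal \<zeta>"
      using cq(1,2) by blast
  next
    assume "\<theta> \<in> {0<..1/2}"
    then show "\<exists>c2>0. \<exists>\<eta>2\<in>{0<..<1}. \<forall>\<^sub>F k in sequentially. \<bar>F (x k) - ereal \<zeta>\<bar> \<le> ereal (c2 * \<eta>2 ^ k)"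
      using rates(1) by (simp add: F)
  next
    assume "\<theta> \<in> {1/2<..<1}"
    then show "\<exists>c3>0. \<forall>\<^sub>F k in sequentially.
       \<bar>F (x k) - ereal \<zeta>\<bar> \<le> ereal (c3 * real k powr (- (1 / (2 * \<theta> - 1))))"
      using rates(3) by (simp add: F)
  qed
qed

end
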